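(* Let $\gamma:\mathbb{R}\to\mathbb{R}$ be real analytic with bounded derivative and let $\Lambda=(\mu,\lambda)\in\mathcal{U}$. A basis for $\ker\mathcal{L}(\Lambda)$ is then given by $\{\Phi_n\}_{n\in M}$, where $$\Phi_n(x,s):=\cos(n\kappa x)\,u(s;n^2\kappa^2)$$ and $M=M(\Lambda)$ is the finite set of all $n\in\mathbb{N}_0$ satisfying the kernel equation $$l(n^2\kappa^2,\Lambda)=r(\Lambda),\qquad\text{where } r(\Lambda):=\frac{1}{\lambda^2}-\frac{\gamma(\mu)}{\lambda}.$$
   Context: Fix $\kappa>0$ and $\beta\in(0,1)$; $\mathbb{N}_0=\{0,1,2,\dots\}$. Standing assumption: $\gamma:\mathbb{R}\to\mathbb{R}$ is real analytic with bounded derivative. $\Omega=\{(x,s)\in\mathbb{R}^2:0<s<1\}$, $S=\mathbb{R}\times\{1\}$, $B=\mathbb{R}\times\{0\}$. Subscripts $\kappa,\mathrm{e}$ on Hölder spaces denote $2\pi/\kappa$-periodicity and evenness in $x$, respectively. $X_2=\{\Phi\in C^{2,\beta}_{\kappa,\mathrm{e}}(\overline\Omega):\Phi|_B=0\}$, $Y=C^{1,\beta}_{\kappa,\mathrm{e}}(\mathbb{R})\times C^{\beta}_{\kappa,\mathrm{e}}(\overline\Omega)$. $\mathcal{U}=\{\Lambda=(\mu,\lambda)\in\mathbb{R}^2:\lambda\neq0\}$. For $\Lambda=(\mu,\lambda)$, $\overline{\psi}=\overline{\psi}(\cdot;\Lambda)$ is the solution on $[0,1]$ of $\overline{\psi}''+\gamma(\overline{\psi})=0$,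 $\overline{\psi}(1)=\mu$, $\overline{\psi}'(1)=\lambda$. The operator $\mathcal{L}(\Lambda)=(\mathcal{L}_1(\Lambda),\mathcal{L}_2(\Lambda)):X_2\to Y$ is $$\mathcal{L}_1(\Lambda)\Phi=\Big[\lambda\Phi_s+\Big(\gamma(\mu)-\frac1\lambda\Big)\Phi\Big]_{S},\qquad \mathcal{L}_2(\Lambda)\Phi=(\Delta+\gamma'(\overline{\psi}))\Phi,$$ with $\Delta=\partial_x^2+\partial_s^2$. $u=u(s;z)$ (depending also on $\Lambda$ through $\overline\psi$) is the solution of $u''(s;z)+(\gamma'(\overline{\psi}(s))-z)u(s;z)=0$, $u(0;z)=0$, $u'(0;z)=1$ (primes are $s$-derivatives), and $l(z,\Lambda)=u'(1;z)/u(1;z)$, which is meromorphic in $z$; the kernel equation is not satisfied at a pole of $l$. *)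

theory Defs
  imports "HOL-Analysis.Analysis" "HOL-Library.Function_Algebras"
begin

text \<open>Functions form a real vector space under pointwise operations, so that
  \<^const>\<open>span\<close> and \<^const>\<open>independent\<close> apply to them.\<close>

instantiation "fun" :: (type, scaleR) scaleR
begin

definition scaleR_fun_def: "c *\<^sub>R f = (\<lambda>x. c *\<^sub>R f x)"

instance ..

end

instance "fun" :: (type, real_vector) real_vector
  by standard (simp_all add: scaleR_fun_def fun_eq_iff scaleR_add_right scaleR_add_left)

lemma scaleR_fun_apply [simp]: "(c *\<^sub>R f) x = c *\<^sub>R f x"
  by (simp add: scaleR_fun_def)

definition real_analytic :: "(real \<Rightarrow> real) \<Rightarrow> bool" where
  "real_analytic g \<longleftrightarrow> (\<forall>x. \<exists>F. (\<lambda>h. g (x + h)) has_fps_expansion F)"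

subsection \<open>Hoelder spaces on the closed strip\<close>

definition Omega :: "(real \<times> real) set" where
  "Omega = {(x, s). 0 < s \<and> s < 1}"

definition pdiff :: "'a::euclidean_space set \<Rightarrow> 'a \<Rightarrow> ('a \<Rightarrow> real) \<Rightarrow> 'a \<Rightarrow> real" where
  "pdiff D b f = (\<lambda>z. frechet_derivative f (at z within D) b)"

text \<open>Derivatives are taken relative to \<open>D\<close>. On the closed strip this is equivalent to asking for
  derivatives in the interior that extend continuously to the boundary. Boundedness of the
  derivatives is finiteness of the Hoelder norm, so derivatives below the top order need
  no separate continuity condition.\<close>

primrec holder_class ::
  "'a::euclidean_space set \<Rightarrow> real \<Rightarrow> nat \<Rightarrow> ('a \<Rightarrow> real) \<Rightarrow> bool" where
  "holder_class D \<beta> 0 f \<longleftrightarrow>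
     bounded (f ` D) \<and> (\<exists>C. \<forall>z\<in>D. \<forall>w\<in>D. \<bar>f z - f w\<bar> \<le> C * dist z w powr \<beta>)"
| "holder_class D \<beta> (Suc k) f \<longleftrightarrow>
     bounded (f ` D) \<and> f differentiable_on D \<and> (\<forall>b\<in>Basis. holder_class D \<beta> k (pdiff D b f))"

text \<open>A function on the closed strip is represented by its extension by zero to the whole plane,
  which makes the representation unique.\<close>

definition X2 :: "real \<Rightarrow> real \<Rightarrow> (real \<times> real \<Rightarrow> real) set" where
  "X2 \<kappa> \<beta> = {\<Phi>. holder_class (closure Omega) \<beta> 2 \<Phi>
     \<and> (\<forall>x s. \<Phi> (x + 2 * pi / \<kappa>, s) = \<Phi> (x, s))
     \<and> (\<forall>x s. \<Phi> (- x, s) = \<Phi> (x, s))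
     \<and> (\<forall>x. \<Phi> (x, 0) = 0)
     \<and> (\<forall>z. z \<notin> closure Omega \<longrightarrow> \<Phi> z = 0)}"

subsection \<open>Trivial flows\<close>

text \<open>\<open>y\<close> solves \<open>y'' = F s y\<close> on \<open>[0,1]\<close> with \<open>y t = a\<close> and \<open>y' t = b\<close>; outside \<open>[0,1]\<close> it is
  set to zero, so that the solution is unique as a function on the reals.\<close>

definition ivp_solution ::
  "(real \<Rightarrow> real \<Rightarrow> real) \<Rightarrow> real \<Rightarrow> real \<Rightarrow> real \<Rightarrow> (real \<Rightarrow> real) \<Rightarrow> bool" where
  "ivp_solution F t a b y \<longleftrightarrow>
     (\<exists>v. y t = a \<and> v t = b \<and>
        (\<forall>s\<in>{0..1}. (y has_real_derivative v s) (at s within {0..1})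
                   \<and> (v has_real_derivative F s (y s)) (at s within {0..1})))
     \<and> (\<forall>s. s \<notin> {0..1} \<longrightarrow> y s = 0)"

definition psi_bar :: "(real \<Rightarrow> real) \<Rightarrow> real \<Rightarrow> real \<Rightarrow> real \<Rightarrow> real" where
  "psi_bar \<gamma> \<mu> lam = (THE \<psi>. ivp_solution (\<lambda>s y. - \<gamma> y) 1 \<mu> lam \<psi>)"

definition u_sol :: "(real \<Rightarrow> real) \<Rightarrow> real \<Rightarrow> real \<Rightarrow> real \<Rightarrow> real \<Rightarrow> real" where
  "u_sol \<gamma> \<mu> lam z =
     (THE u. ivp_solution (\<lambda>s y. - (deriv \<gamma> (psi_bar \<gamma> \<mu> lam s) - z) * y) 0 0 1 u)"

subsection \<open>The linearised operator\<close>

definition L1 :: "(real \<Rightarrow> real) \<Rightarrow> real \<Rightarrow> real \<Rightarrow> (real \<times> real \<Rightarrow> real) \<Rightarrow> real \<Rightarrow> real" where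
  "L1 \<gamma> \<mu> lam \<Phi> = (\<lambda>x. lam * pdiff (closure Omega) (0, 1) \<Phi> (x, 1)
     + (\<gamma> \<mu> - 1 / lam) * \<Phi> (x, 1))"

definition laplacian :: "(real \<times> real \<Rightarrow> real) \<Rightarrow> real \<times> real \<Rightarrow> real" where
  "laplacian \<Phi> = (\<lambda>z. pdiff (closure Omega) (1, 0) (pdiff (closure Omega) (1, 0) \<Phi>) z
     + pdiff (closure Omega) (0, 1) (pdiff (closure Omega) (0, 1) \<Phi>) z)"

definition L2 ::
  "(real \<Rightarrow> real) \<Rightarrow> real \<Rightarrow> real \<Rightarrow> (real \<times> real \<Rightarrow> real) \<Rightarrow> real \<times> real \<Rightarrow> real" where
  "L2 \<gamma> \<mu> lam \<Phi> = (\<lambda>z. if z \<in> closure Omega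
     then laplacian \<Phi> z + deriv \<gamma> (psi_bar \<gamma> \<mu> lam (snd z)) * \<Phi> z else 0)"

definition ker_L ::
  "real \<Rightarrow> real \<Rightarrow> (real \<Rightarrow> real) \<Rightarrow> real \<Rightarrow> real \<Rightarrow> (real \<times> real \<Rightarrow> real) set" where
  "ker_L \<kappa> \<beta> \<gamma> \<mu> lam = {\<Phi> \<in> X2 \<kappa> \<beta>. (L1 \<gamma> \<mu> lam \<Phi>, L2 \<gamma> \<mu> lam \<Phi>) = (0, 0)}"

subsection \<open>The kernel equation\<close>

definition l_fun :: "(real \<Rightarrow> real) \<Rightarrow> real \<Rightarrow> real \<Rightarrow> real \<Rightarrow> real" where
  "l_fun \<gamma> \<mu> lam z =
     vector_derivative (u_sol \<gamma> \<mu> lam z) (at 1 within {0..1}) / u_sol \<gamma> \<mu> lam z 1"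

definition r_fun :: "(real \<Rightarrow> real) \<Rightarrow> real \<Rightarrow> real \<Rightarrow> real" where
  "r_fun \<gamma> \<mu> lam = 1 / lam\<^sup>2 - \<gamma> \<mu> / lam"

text \<open>The poles of \<^const>\<open>l_fun\<close> are the zeros of \<open>u(1; z)\<close>, since \<open>u\<close> and \<open>u'\<close> do not vanish
  simultaneously. They are excluded explicitly because division by zero yields zero.\<close>

definition kernel_equation :: "(real \<Rightarrow> real) \<Rightarrow> real \<Rightarrow> real \<Rightarrow> real \<Rightarrow> bool" where
  "kernel_equation \<gamma> \<mu> lam z \<longleftrightarrow>
     u_sol \<gamma> \<mu> lam z 1 \<noteq> 0 \<and> l_fun \<gamma> \<mu> lam z = r_fun \<gamma> \<mu> lam"

definition M_set :: "real \<Rightarrow> (real \<Rightarrow> real) \<Rightarrow> real \<Rightarrow> real \<Rightarrow> nat set" where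
  "M_set \<kappa> \<gamma> \<mu> lam = {n. kernel_equation \<gamma> \<mu> lam ((real n)\<^sup>2 * \<kappa>\<^sup>2)}"

definition Phi ::
  "real \<Rightarrow> (real \<Rightarrow> real) \<Rightarrow> real \<Rightarrow> real \<Rightarrow> nat \<Rightarrow> real \<times> real \<Rightarrow> real" where
  "Phi \<kappa> \<gamma> \<mu> lam n =
     (\<lambda>(x, s). cos (real n * \<kappa> * x) * u_sol \<gamma> \<mu> lam ((real n)\<^sup>2 * \<kappa>\<^sup>2) s)"

text \<open>A family is a basis of a subspace \<open>V\<close> if it is linearly independent as a family
  (in particular injective) and spans \<open>V\<close>.\<close>

definition basis_family :: "('i \<Rightarrow> 'v::real_vector) \<Rightarrow> 'i set \<Rightarrow> 'v set \<Rightarrow> bool" where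
  "basis_family b I V \<longleftrightarrow> inj_on b I \<and> independent (b ` I) \<and> span (b ` I) = V"

end

theory Submission
  imports Defs
begin

text \<open>
  Separation of variables. On the half period \<open>[0, \<pi>/\<kappa>]\<close> the functions \<open>cos (n \<kappa> x)\<close> form a complete
  orthogonal system for even periodic functions. A kernel element \<open>\<Phi>\<close> is therefore determined by its cosine
  coefficients \<open>\<phi>\<^sub>n(s)\<close>, and these can be computed: differentiating under the integral and integrating by parts
  in \<open>x\<close> turns \<open>\<Delta>\<Phi> + \<gamma>'(\<psi>)\<Phi> = 0\<close> into the equation that defines \<open>u(s; n\<^sup>2\<kappa>\<^sup>2)\<close>, and \<open>\<Phi>\<close> vanishes on the bed,
  so \<open>\<phi>\<^sub>n = c\<^sub>n u(\<cdot>; n\<^sup>2\<kappa>\<^sup>2)\<close>. The boundary condition at the surface then says that \<open>c\<^sub>n = 0\<close> or that \<open>n\<close> satisfies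
  the kernel equation (\<open>cos_coefficient_of_kernel_element\<close>). Here a pole of \<open>l\<close> cannot occur, since a
  nontrivial solution and its derivative do not vanish together.

  Only finitely many \<open>n\<close> qualify (\<open>kernel_equation_bound\<close>), because for large \<open>z\<close> the quotient \<open>u'/u\<close> at the
  surface exceeds any given constant; this is proved through the monotone quantity \<open>u u' - r u\<^sup>2\<close>. Hence
  \<open>\<Phi>\<close> minus a finite combination of modes is a kernel element without cosine coefficients, which is zero by
  completeness (\<open>cosine_system_complete\<close>, a consequence of the Weierstrass theorem). Conversely each mode with
  \<open>n\<close> in the set lies in the kernel (\<open>mode_in_ker_L\<close>), and the modes are independent because the cosines are
  orthogonal and \<open>u(1; n\<^sup>2\<kappa>\<^sup>2) \<noteq> 0\<close>.

  The remaining ingredients are the existence and uniqueness of the solutions \<open>\<psi>\<close> and \<open>u\<close> on the whole interval,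
  which holds because the nonlinearities are globally Lipschitz (\<open>ivp_solution_ex1\<close>), and the
  fact that a mode has the required Hoelder regularity, being a product of a function of \<open>x\<close> and a function of
  \<open>s\<close> whose derivatives up to second order are bounded and Lipschitz (\<open>holder_class_2_separated\<close>).
\<close>

section \<open>Initial value problems on the unit interval\<close>

text \<open>The solution on the whole interval comes from a single application of the Banach fixed point theorem,
however large the Lipschitz constant is: the integral operator is conjugated with multiplication by
\<open>exp (- L s)\<close>, which turns its Lipschitz constant in the supremum norm into \<open>\<bar>K\<bar> / L\<close>. The space of
bounded continuous functions lives on the whole line, so values outside the interval are filled in by
clamping the argument.\<close>

lemma lipschitz_ode_solution_exists:
  fixes G :: "real \<Rightarrow> 'a::banach \<Rightarrow> 'a"
  assumes cont: "continuous_on ({0..1} \<times> UNIV) (\<lambda>(s, y). G s y)"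
    and lip: "\<And>s y z. s \<in> {0..1} \<Longrightarrow> norm (G s y - G s z) \<le> K * norm (y - z)"
  shows "\<exists>Y. Y 0 = Y0 \<and>
    (\<forall>s\<in>{0..1}. (Y has_vector_derivative G s (Y s)) (at s within {0..1}))"
proof -
  \<comment> \<open>Any weight above \<open>\<bar>K\<bar>\<close> gives a contraction; this one makes the ratio at most one half.\<close>
  define L where "L = 2 * \<bar>K\<bar> + 1"
  have L: "L > 0" "\<bar>K\<bar> / L \<le> 1/2" by (auto simp: L_def field_simps)
  define H where "H f r = G r (exp (L * r) *\<^sub>R apply_bcontfun f r)" for f r
  define P where "P f s = exp (- (L * s)) *\<^sub>R (Y0 + integral {0..s} (H f))" for f s
  define T where "T f = Bcontfun (ext_cont (P f) 0 1)" for f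
  have H_cont: "continuous_on {0..1} (H f)" for f
  proof -
    have "continuous_on {0..1} (\<lambda>r. (\<lambda>(s, y). G s y) (r, exp (L * r) *\<^sub>R apply_bcontfun f r))"
      by (rule continuous_on_compose2[OF cont]) (auto intro!: continuous_intros)
    then show ?thesis by (simp add: H_def[abs_def])
  qed
  have H_int: "H f integrable_on {0..s}" if "s \<in> {0..1}" for f s
    using that by (intro integrable_continuous_real continuous_on_subset[OF H_cont]) auto
  have P_cont: "continuous_on {0..1} (P f)" for f
    unfolding P_def[abs_def]
    by (intro continuous_intros indefinite_integral_continuous_1 H_int) auto
  have T_apply: "apply_bcontfun (T f) s = P f (clamp 0 1 s)" for f s
  proof -
    have "ext_cont (P f) 0 1 \<in> bcontfun"
      using P_cont[of f] compact_imp_bounded[OF compact_continuous_image[OF P_cont compact_Icc], of f]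
      by (auto simp: bcontfun_def ext_cont_def[abs_def] intro!: clamp_continuous_on clamp_bounded
          elim: bounded_subset)
    then show ?thesis by (simp add: T_def Bcontfun_inverse ext_cont_def)
  qed
  have contr: "dist (T f) (T g) \<le> 1/2 * dist f g" for f g
  proof (rule dist_bound)
    fix x
    define s where "s = clamp 0 1 (x::real)"
    have s: "s \<in> {0..1}" using clamp_in_interval[of 0 1 x] by (simp add: s_def)
    have E: "((\<lambda>r. exp (L * r)) has_integral (exp (L * s) / L - exp (L * 0) / L)) {0..s}"
      using s L by (intro fundamental_theorem_of_calculus)
        (auto intro!: derivative_eq_intros simp flip: has_real_derivative_iff_has_vector_derivative)
    have E2: "((\<lambda>r. \<bar>K\<bar> * dist f g * exp (L * r)) has_integral
        \<bar>K\<bar> * dist f g * (exp (L * s) / L - 1 / L)) {0..s}"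
      using has_integral_mult_right[OF E, of "\<bar>K\<bar> * dist f g"] by simp
    have "norm (integral {0..s} (\<lambda>r. H f r - H g r)) \<le> integral {0..s} (\<lambda>r. \<bar>K\<bar> * dist f g * exp (L * r))"
    proof (rule integral_norm_bound_integral)
      show "(\<lambda>r. H f r - H g r) integrable_on {0..s}" by (intro integrable_diff H_int s)
      show "(\<lambda>r. \<bar>K\<bar> * dist f g * exp (L * r)) integrable_on {0..s}" using E2 by blast
      fix r assume r: "r \<in> {0..s}"
      have "norm (H f r - H g r) \<le> K * norm (exp (L * r) *\<^sub>R apply_bcontfun f r - exp (L * r) *\<^sub>R apply_bcontfun g r)"
        unfolding H_def using r s by (intro lip) auto
      also have "\<dots> = K * (exp (L * r) * dist (apply_bcontfun f r) (apply_bcontfun g r))"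
        by (simp add: dist_norm flip: scaleR_diff_right)
      also have "\<dots> \<le> \<bar>K\<bar> * (exp (L * r) * dist f g)"
        by (intro mult_mono dist_bounded) auto
      finally show "norm (H f r - H g r) \<le> \<bar>K\<bar> * dist f g * exp (L * r)" by (simp add: mult_ac)
    qed
    also have "\<dots> = \<bar>K\<bar> * dist f g * (exp (L * s) / L - 1 / L)" by (rule integral_unique[OF E2])
    also have "\<dots> \<le> \<bar>K\<bar> * dist f g * (exp (L * s) / L)" using L by (intro mult_left_mono) auto
    also have "integral {0..s} (\<lambda>r. H f r - H g r) = integral {0..s} (H f) - integral {0..s} (H g)"
      by (intro Henstock_Kurzweil_Integration.integral_diff H_int s)
    finally have *: "norm (integral {0..s} (H f) - integral {0..s} (H g)) \<le> \<bar>K\<bar> / L * dist f g * exp (L * s)"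
      by (simp add: mult_ac)
    have "dist (P f s) (P g s) = exp (- (L * s)) * norm (integral {0..s} (H f) - integral {0..s} (H g))"
      by (simp add: P_def dist_norm flip: scaleR_diff_right)
    also have "\<dots> \<le> exp (- (L * s)) * (\<bar>K\<bar> / L * dist f g * exp (L * s))"
      using * by (intro mult_left_mono) auto
    also have "\<dots> = \<bar>K\<bar> / L * dist f g" by (simp add: exp_minus field_simps)
    also have "\<dots> \<le> 1/2 * dist f g" using L by (intro mult_right_mono) auto
    finally show "dist (apply_bcontfun (T f) x) (apply_bcontfun (T g) x) \<le> 1/2 * dist f g"
      by (simp add: T_apply s_def)
  qed
  then obtain f where f: "T f = f" using banach_fix_type[of "1/2" T] by auto
  \<comment> \<open>Undoing the weight turns the fixed point into the solution: \<open>Y s = exp (L * s) *\<^sub>R f s\<close>.\<close>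
  define Y where "Y s = Y0 + integral {0..s} (H f)" for s
  have HY: "H f s = G s (Y s)" if "s \<in> {0..1}" for s
  proof -
    have "apply_bcontfun f s = P f s"
      using T_apply[of f s] that unfolding f by simp
    then show ?thesis by (simp add: H_def P_def Y_def exp_minus)
  qed
  have "(Y has_vector_derivative G s (Y s)) (at s within {0..1})" if "s \<in> {0..1}" for s
    unfolding Y_def[abs_def] using integral_has_vector_derivative[OF H_cont that, of f] HY[OF that]
    by (auto intro!: derivative_eq_intros simp: Y_def)
  moreover have "Y 0 = Y0" by (simp add: Y_def)
  ultimately show ?thesis by blast
qed

text \<open>The squared distance of two solutions grows at most at the rate \<open>2 * K\<close>, so multiplied by
\<open>exp (- 2 * K * s)\<close> it is nonincreasing; it starts at zero.\<close>

lemma lipschitz_ode_solution_unique: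
  fixes Y Z :: "real \<Rightarrow> 'a::real_inner"
  assumes lip: "\<And>s y z. s \<in> {0..1} \<Longrightarrow> norm (G s y - G s z) \<le> K * norm (y - z)"
    and Y: "\<And>s. s \<in> {0..1} \<Longrightarrow> (Y has_vector_derivative G s (Y s)) (at s within {0..1})"
    and Z: "\<And>s. s \<in> {0..1} \<Longrightarrow> (Z has_vector_derivative G s (Z s)) (at s within {0..1})"
    and init: "Y 0 = Z 0" and s: "s \<in> {0..1}"
  shows "Y s = Z s"
proof -
  define E where "E s = exp (- 2 * K * s) * ((Y s - Z s) \<bullet> (Y s - Z s))" for s
  define E' where "E' s = exp (- 2 * K * s) * (2 * ((Y s - Z s) \<bullet> (G s (Y s) - G s (Z s)))
      - 2 * K * ((Y s - Z s) \<bullet> (Y s - Z s)))" for s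
  have "E s \<le> E 0"
  proof (rule DERIV_nonpos_imp_decreasing_open[of 0 s E])
    show "0 \<le> s" using s by simp
    have D: "(E has_real_derivative E' r) (at r within {0..1})" if "r \<in> {0..1}" for r
      unfolding E_def[abs_def] E'_def has_field_derivative_def
      using Y[OF that, unfolded has_vector_derivative_def] Z[OF that, unfolded has_vector_derivative_def]
      by (auto intro!: derivative_eq_intros simp: fun_eq_iff algebra_simps inner_commute)
    have "continuous_on {0..1} E" using D DERIV_continuous_on by blast
    then show "continuous_on {0..s} E" by (rule continuous_on_subset) (use s in auto)
    fix r assume r: "0 < r" "r < s"
    have "(Y r - Z r) \<bullet> (G r (Y r) - G r (Z r)) \<le> norm (Y r - Z r) * norm (G r (Y r) - G r (Z r))"
      by (rule norm_cauchy_schwarz)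
    also have "\<dots> \<le> norm (Y r - Z r) * (K * norm (Y r - Z r))"
      using r s by (intro mult_left_mono lip) auto
    finally have "E' r \<le> 0"
      by (auto simp: E'_def mult_le_0_iff dot_square_norm power2_eq_square mult_ac)
    moreover have "(E has_real_derivative E' r) (at r)"
      using D[of r] r s by (simp add: at_within_Icc_at)
    ultimately show "\<exists>y. DERIV E r :> y \<and> y \<le> 0" by blast
  qed
  then have "(Y s - Z s) \<bullet> (Y s - Z s) \<le> 0"
    using init by (simp add: E_def mult_le_0_iff)
  then show ?thesis by (metis inner_gt_zero_iff leD eq_iff_diff_eq_0)
qed

lemma ivp_solutionE:
  assumes "ivp_solution F t a b y"
  obtains v where "y t = a" "v t = b"
    "\<And>s. s \<in> {0..1} \<Longrightarrow> (y has_real_derivative v s) (at s within {0..1})"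
    "\<And>s. s \<in> {0..1} \<Longrightarrow> (v has_real_derivative F s (y s)) (at s within {0..1})"
    "\<And>s. s \<notin> {0..1} \<Longrightarrow> y s = 0"
  using assms unfolding ivp_solution_def by blast

text \<open>Reflecting the interval exchanges its end points. Since the reflection is an involution, existence and
uniqueness for data at \<open>1\<close> both reduce to data at \<open>0\<close>.\<close>

lemma ivp_solution_reflect:
  assumes "ivp_solution F t a b y"
  shows "ivp_solution (\<lambda>s. F (1 - s)) (1 - t) a (- b) (\<lambda>s. y (1 - s))"
proof -
  obtain v where v: "y t = a" "v t = b"
    "\<And>s. s \<in> {0..1} \<Longrightarrow> (y has_real_derivative v s) (at s within {0..1})"
    "\<And>s. s \<in> {0..1} \<Longrightarrow> (v has_real_derivative F s (y s)) (at s within {0..1})"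
    "\<And>s. s \<notin> {0..1} \<Longrightarrow> y s = 0"
    using assms unfolding ivp_solution_def by blast
  have img: "(\<lambda>s. 1 - s) ` {0..1} = {0..1::real}" by (simp add: image_diff_atLeastAtMost)
  have refl: "((\<lambda>s. f (1 - s)) has_real_derivative - f') (at s within {0..1})"
    if "(f has_real_derivative f') (at (1 - s) within {0..1})" for f f' s
  proof -
    have "(f has_real_derivative f') (at (1 - s) within (\<lambda>s. 1 - s) ` {0..1})"
      using that by (simp add: img)
    moreover have "((\<lambda>s. 1 - s) has_real_derivative - 1) (at s within {0..1})"
      by (auto intro!: derivative_eq_intros)
    ultimately show ?thesis using DERIV_image_chain by (fastforce simp: o_def)
  qed
  show ?thesis
    unfolding ivp_solution_def
  proof (intro exI[of _ "\<lambda>s. - v (1 - s)"] conjI allI impI ballI)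
    fix s :: real assume "s \<in> {0..1}"
    then have s: "1 - s \<in> {0..1}" by auto
    show "((\<lambda>s. y (1 - s)) has_real_derivative - v (1 - s)) (at s within {0..1})"
      by (rule refl[OF v(3)[OF s]])
    show "((\<lambda>s. - v (1 - s)) has_real_derivative F (1 - s) (y (1 - s))) (at s within {0..1})"
      using DERIV_minus[OF refl[OF v(4)[OF s]]] by simp
  qed (use v in auto)
qed

text \<open>The second order equation is the first order system for the pair of \<open>y\<close> and its derivative.\<close>

lemma ivp_solution_ex1:
  fixes F :: "real \<Rightarrow> real \<Rightarrow> real"
  assumes cont: "continuous_on ({0..1} \<times> UNIV) (\<lambda>(s, y). F s y)"
    and lip: "\<And>s y z. s \<in> {0..1} \<Longrightarrow> \<bar>F s y - F s z\<bar> \<le> K * \<bar>y - z\<bar>"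
    and t: "t = 0 \<or> t = 1"
  shows "\<exists>!y. ivp_solution F t a b y"
proof -
  have at_0: "\<exists>!y. ivp_solution F 0 a b y"
    if cont: "continuous_on ({0..1} \<times> UNIV) (\<lambda>(s, y). F s y)"
    and lip: "\<And>s y z. s \<in> {0..1} \<Longrightarrow> \<bar>F s y - F s z\<bar> \<le> K * \<bar>y - z\<bar>" for F b
  proof -
    define G where "G s p = (snd p, F s (fst p))" for s and p :: "real \<times> real"
    have G_cont: "continuous_on ({0..1} \<times> UNIV) (\<lambda>(s, p). G s p)"
    proof -
      have "continuous_on ({0..1} \<times> UNIV) (\<lambda>z::real \<times> real \<times> real. (\<lambda>(s, y). F s y) (fst z, fst (snd z)))"
        by (rule continuous_on_compose2[OF cont]) (auto intro!: continuous_intros)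
      then show ?thesis
        by (auto simp: G_def[abs_def] case_prod_beta intro!: continuous_intros)
    qed
    have G_lip: "norm (G s p - G s q) \<le> (1 + \<bar>K\<bar>) * norm (p - q)" if "s \<in> {0..1}" for s p q
    proof -
      have "norm (G s p - G s q) \<le> norm (snd p - snd q) + norm (F s (fst p) - F s (fst q))"
        using norm_Pair_le[of "snd p - snd q" "F s (fst p) - F s (fst q)"] by (simp add: G_def)
      also have "\<dots> \<le> norm (p - q) + \<bar>K\<bar> * norm (p - q)"
      proof (rule add_mono)
        show "norm (snd p - snd q) \<le> norm (p - q)"
          by (metis norm_snd_le prod.collapse snd_diff)
        have "norm (fst p - fst q) \<le> norm (p - q)"
          by (metis norm_fst_le prod.collapse fst_diff)
        then have "\<bar>K\<bar> * \<bar>fst p - fst q\<bar> \<le> \<bar>K\<bar> * norm (p - q)"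
          by (intro mult_left_mono) auto
        moreover have "K * \<bar>fst p - fst q\<bar> \<le> \<bar>K\<bar> * \<bar>fst p - fst q\<bar>" by (intro mult_right_mono) auto
        ultimately show "norm (F s (fst p) - F s (fst q)) \<le> \<bar>K\<bar> * norm (p - q)"
          using lip[OF that, of "fst p" "fst q"] by simp
      qed
      finally show ?thesis by (simp add: algebra_simps)
    qed
    show ?thesis
    proof (rule ex_ex1I)
      obtain Y where Y0: "Y 0 = (a, b)"
        and Y: "\<And>s. s \<in> {0..1} \<Longrightarrow> (Y has_vector_derivative G s (Y s)) (at s within {0..1})"
        using lipschitz_ode_solution_exists[OF G_cont G_lip] by blast
      define y where "y s = (if s \<in> {0..1} then fst (Y s) else 0)" for s
      have "((\<lambda>s. fst (Y s)) has_real_derivative snd (Y s)) (at s within {0..1})"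
        "((\<lambda>s. snd (Y s)) has_real_derivative F s (fst (Y s))) (at s within {0..1})"
        if "s \<in> {0..1}" for s
        using has_derivative_fst[OF Y[OF that, unfolded has_vector_derivative_def]]
          has_derivative_snd[OF Y[OF that, unfolded has_vector_derivative_def]]
        by (auto simp: G_def has_field_derivative_def mult_commute_abs)
      moreover note Y_fst = this(1)
      have "(y has_real_derivative snd (Y s)) (at s within {0..1})"
        if "s \<in> {0..1}" for s
        by (rule has_field_derivative_transform_within[OF Y_fst[OF that] zero_less_one])
          (use that in \<open>auto simp: y_def\<close>)
      ultimately have "ivp_solution F 0 a b y"
        unfolding ivp_solution_def using Y0
        by (intro exI[of _ "\<lambda>s. snd (Y s)"] conjI ballI) (simp_all add: y_def)
      then show "\<exists>y. ivp_solution F 0 a b y" by blast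
    next
      fix y z assume "ivp_solution F 0 a b y" "ivp_solution F 0 a b z"
      then obtain v w where
        v: "y 0 = a" "v 0 = b"
          "\<And>s. s \<in> {0..1} \<Longrightarrow> (y has_real_derivative v s) (at s within {0..1})"
          "\<And>s. s \<in> {0..1} \<Longrightarrow> (v has_real_derivative F s (y s)) (at s within {0..1})"
          "\<And>s. s \<notin> {0..1} \<Longrightarrow> y s = 0" and
        w: "z 0 = a" "w 0 = b"
          "\<And>s. s \<in> {0..1} \<Longrightarrow> (z has_real_derivative w s) (at s within {0..1})"
          "\<And>s. s \<in> {0..1} \<Longrightarrow> (w has_real_derivative F s (z s)) (at s within {0..1})"
          "\<And>s. s \<notin> {0..1} \<Longrightarrow> z s = 0"
        unfolding ivp_solution_def by blast
      have "(y s, v s) = (z s, w s)" if "s \<in> {0..1}" for s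
      proof (rule lipschitz_ode_solution_unique[OF G_lip _ _ _ that])
        fix r :: real assume r: "r \<in> {0..1}"
        show "((\<lambda>s. (y s, v s)) has_vector_derivative G r (y r, v r)) (at r within {0..1})"
          using v(3,4)[OF r] by (auto simp: G_def has_real_derivative_iff_has_vector_derivative
              intro!: has_vector_derivative_Pair)
        show "((\<lambda>s. (z s, w s)) has_vector_derivative G r (z r, w r)) (at r within {0..1})"
          using w(3,4)[OF r] by (auto simp: G_def has_real_derivative_iff_has_vector_derivative
              intro!: has_vector_derivative_Pair)
      qed (use v w in auto)
      then show "y = z" using v(5) w(5) by (metis ext prod.inject)
    qed
  qed
  show ?thesis
  proof (cases "t = 0")
    case True
    then show ?thesis using at_0[OF cont lip] by blast
  next
    case False
    then have t: "t = 1" using t by blast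
    have "continuous_on ({0..1} \<times> UNIV) (\<lambda>z::real \<times> real. (\<lambda>(s, y). F s y) (1 - fst z, snd z))"
      by (rule continuous_on_compose2[OF cont]) (auto intro!: continuous_intros)
    then have cont': "continuous_on ({0..1} \<times> UNIV) (\<lambda>(s, y). F (1 - s) y)"
      by (simp add: case_prod_beta)
    have ex1: "\<exists>!y. ivp_solution (\<lambda>s. F (1 - s)) 0 a (- b) y"
      by (rule at_0[OF cont']) (auto intro: lip)
    have reflected: "ivp_solution (\<lambda>s. F (1 - s)) 0 a (- b) (\<lambda>s. y (1 - s))"
      if "ivp_solution F 1 a b y" for y
      using ivp_solution_reflect[OF that] by simp
    have unreflected: "ivp_solution F 1 a b (\<lambda>s. y (1 - s))"
      if "ivp_solution (\<lambda>s. F (1 - s)) 0 a (- b) y" for y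
      using ivp_solution_reflect[OF that] by simp
    show ?thesis
    proof (rule ex_ex1I)
      show "\<exists>y. ivp_solution F t a b y" using ex1 unreflected t by blast
    next
      fix y z assume "ivp_solution F t a b y" "ivp_solution F t a b z"
      then have "(\<lambda>s. y (1 - s)) = (\<lambda>s. z (1 - s))" using ex1 reflected t by blast
      then have "y (1 - (1 - s)) = z (1 - (1 - s))" for s by (rule fun_cong)
      then show "y = z" by (simp add: fun_eq_iff)
    qed
  qed
qed

section \<open>Real analytic nonlinearities and the trivial flow\<close>

lemma real_analytic_differentiable:
  assumes "real_analytic g"
  shows "(g has_real_derivative deriv g x) (at x)"
proof -
  obtain F where F: "(\<lambda>h. g (x + h)) has_fps_expansion F"
    using assms unfolding real_analytic_def by blast
  have "(eval_fps F has_real_derivative eval_fps (fps_deriv F) 0) (at 0)"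
    using F by (intro has_field_derivative_eval_fps) (auto simp: has_fps_expansion_def zero_ereal_def)
  moreover have "eventually (\<lambda>h. eval_fps F h = g (x + h)) (nhds 0)"
    using F by (simp add: has_fps_expansion_def)
  ultimately have "((\<lambda>h. g (x + h)) has_real_derivative eval_fps (fps_deriv F) 0) (at 0)"
    by (rule iffD1[OF DERIV_cong_ev[OF refl _ refl], rotated])
  then have "(g has_real_derivative eval_fps (fps_deriv F) 0) (at x)"
    using DERIV_shift[of g _ 0 x] by (simp add: add.commute)
  then show ?thesis by (metis DERIV_imp_deriv)
qed

lemma real_analytic_deriv:
  assumes "real_analytic g"
  shows "real_analytic (deriv g)"
  unfolding real_analytic_def
proof
  fix x
  obtain F where F: "(\<lambda>h. g (x + h)) has_fps_expansion F"
    using assms unfolding real_analytic_def by blast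
  have "deriv (\<lambda>h. g (x + h)) = (\<lambda>h. deriv g (x + h))"
  proof
    fix h
    have "((\<lambda>h. g (x + h)) has_real_derivative deriv g (x + h)) (at h)"
      using DERIV_shift[of g "deriv g (x + h)" h x] real_analytic_differentiable[OF assms, of "x + h"]
      by (simp add: add.commute)
    then show "deriv (\<lambda>h. g (x + h)) h = deriv g (x + h)" by (rule DERIV_imp_deriv)
  qed
  then show "\<exists>F. (\<lambda>h. deriv g (x + h)) has_fps_expansion F"
    using has_fps_expansion_deriv[OF F] by auto
qed

lemma continuous_on_real_analytic:
  assumes "real_analytic g" shows "continuous_on S g"
  using real_analytic_differentiable[OF assms]
  by (meson DERIV_continuous continuous_at_imp_continuous_on)

lemma ivp_solution_psi_bar:
  assumes "real_analytic \<gamma>" "bounded (range (deriv \<gamma>))"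
  shows "ivp_solution (\<lambda>s y. - \<gamma> y) 1 \<mu> lam (psi_bar \<gamma> \<mu> lam)"
proof -
  obtain K where K: "\<And>y. \<bar>deriv \<gamma> y\<bar> \<le> K" using assms(2) by (auto simp: bounded_iff)
  have "continuous_on ({0..1} \<times> UNIV) (\<lambda>z::real \<times> real. - \<gamma> (snd z))"
    by (intro continuous_intros continuous_on_compose2[OF continuous_on_real_analytic[OF assms(1), of UNIV]])
      auto
  moreover have "\<bar>- \<gamma> y - - \<gamma> z\<bar> \<le> K * \<bar>y - z\<bar>" for y z
    using field_differentiable_bound[of UNIV \<gamma> "deriv \<gamma>" K z y] K
      real_analytic_differentiable[OF assms(1)] by (auto simp: abs_minus_commute)
  ultimately have "\<exists>!\<psi>. ivp_solution (\<lambda>s y. - \<gamma> y) 1 \<mu> lam \<psi>"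
    by (intro ivp_solution_ex1[of _ K]) (simp_all add: case_prod_beta)
  then show ?thesis
    unfolding psi_bar_def by (rule theI')
qed

text \<open>This regularity of the potential \<open>\<gamma>'(\<psi>)\<close> makes the second derivative of a mode Lipschitz in \<open>s\<close>, hence
Hoelder.\<close>

lemma deriv_psi_bar_C1:
  assumes "real_analytic \<gamma>" "bounded (range (deriv \<gamma>))"
  obtains q' where "continuous_on {0..1} q'"
    "\<And>s. s \<in> {0..1} \<Longrightarrow>
      ((\<lambda>s. deriv \<gamma> (psi_bar \<gamma> \<mu> lam s)) has_real_derivative q' s) (at s within {0..1})"
proof -
  define \<psi> where "\<psi> = psi_bar \<gamma> \<mu> lam"
  obtain v where v:
    "\<And>s. s \<in> {0..1} \<Longrightarrow> (\<psi> has_real_derivative v s) (at s within {0..1})"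
    "\<And>s. s \<in> {0..1} \<Longrightarrow> (v has_real_derivative - \<gamma> (\<psi> s)) (at s within {0..1})"
    using ivp_solution_psi_bar[OF assms, of \<mu> lam] unfolding \<psi>_def by (elim ivp_solutionE) blast
  have cont: "continuous_on {0..1} \<psi>" "continuous_on {0..1} v"
    by (rule DERIV_continuous_on[OF v(1)], assumption) (rule DERIV_continuous_on[OF v(2)])
  note an = real_analytic_deriv[OF assms(1)]
  show ?thesis
  proof
    show "continuous_on {0..1} (\<lambda>s. deriv (deriv \<gamma>) (\<psi> s) * v s)"
      by (intro continuous_intros cont
          continuous_on_compose2[OF continuous_on_real_analytic[OF real_analytic_deriv[OF an], of UNIV]]) auto
    fix s :: real assume "s \<in> {0..1}"
    then show "((\<lambda>s. deriv \<gamma> (psi_bar \<gamma> \<mu> lam s)) has_real_derivative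
        deriv (deriv \<gamma>) (\<psi> s) * v s) (at s within {0..1})"
      using DERIV_chain2[OF real_analytic_differentiable[OF an] v(1)] by (simp add: \<psi>_def)
  qed
qed

lemma linear_ivp_ex1:
  assumes "real_analytic \<gamma>" "bounded (range (deriv \<gamma>))" "t = 0 \<or> t = 1"
  shows "\<exists>!u. ivp_solution (\<lambda>s y. - (deriv \<gamma> (psi_bar \<gamma> \<mu> lam s) - z) * y) t a b u"
proof -
  define q where "q s = deriv \<gamma> (psi_bar \<gamma> \<mu> lam s)" for s
  obtain K where K: "\<And>y. \<bar>deriv \<gamma> y\<bar> \<le> K" using assms(2) by (auto simp: bounded_iff)
  have q_cont: "continuous_on {0..1} q"
    unfolding q_def[abs_def] by (rule deriv_psi_bar_C1[OF assms(1,2)]) (rule DERIV_continuous_on)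
  have "continuous_on ({0..1} \<times> UNIV) (\<lambda>w::real \<times> real. - (q (fst w) - z) * snd w)"
    by (intro continuous_intros continuous_on_compose2[OF q_cont]) auto
  moreover have "\<bar>- (q s - z) * y - - (q s - z) * y'\<bar> \<le> (K + \<bar>z\<bar>) * \<bar>y - y'\<bar>" for s y y'
  proof -
    have "- (q s - z) * y - - (q s - z) * y' = (z - q s) * (y - y')" by (simp add: algebra_simps)
    moreover have "\<bar>z - q s\<bar> \<le> K + \<bar>z\<bar>" using K[of "psi_bar \<gamma> \<mu> lam s"] by (auto simp: q_def)
    ultimately show ?thesis by (simp add: abs_mult mult_right_mono)
  qed
  ultimately have "\<exists>!u. ivp_solution (\<lambda>s y. - (q s - z) * y) t a b u"
    by (intro ivp_solution_ex1[where K = "K + \<bar>z\<bar>", OF _ _ assms(3)]) (simp_all add: case_prod_beta)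
  then show ?thesis unfolding q_def .
qed

lemma ivp_solution_u_sol:
  assumes "real_analytic \<gamma>" "bounded (range (deriv \<gamma>))"
  shows "ivp_solution (\<lambda>s y. - (deriv \<gamma> (psi_bar \<gamma> \<mu> lam s) - z) * y) 0 0 1 (u_sol \<gamma> \<mu> lam z)"
  unfolding u_sol_def by (rule theI'[OF linear_ivp_ex1[OF assms disjI1[OF refl]]])

section \<open>Differential calculus and Hoelder classes on the closed strip\<close>

lemma closure_Omega: "closure Omega = UNIV \<times> {0..1}"
proof -
  have "Omega = UNIV \<times> {0<..<1}" by (auto simp: Omega_def)
  moreover have "closure ((UNIV :: real set) \<times> {0<..<1::real}) = closure UNIV \<times> closure {0<..<1}"
    by (rule closure_Times)
  ultimately show ?thesis by simp
qed

text \<open>At a boundary point one coordinate direction can only be followed to one side, but the one-sided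
difference quotients still determine the derivative.\<close>

lemma has_derivative_unique_strip:
  fixes f :: "real \<times> real \<Rightarrow> real"
  assumes "(f has_derivative f') (at z within closure Omega)"
    and "(f has_derivative f'') (at z within closure Omega)" and z: "z \<in> closure Omega"
  shows "f' = f''"
proof (rule frechet_derivative_unique_within[OF assms(1,2)])
  fix i :: "real \<times> real" and e :: real assume i: "i \<in> Basis" and e: "e > 0"
  obtain x s where xs: "z = (x, s)" "0 \<le> s" "s \<le> 1"
    using z by (cases z) (auto simp: closure_Omega)
  consider "i = (1, 0)" | "i = (0, 1)" using i by (auto simp: Basis_prod_def)
  then show "\<exists>d. 0 < \<bar>d\<bar> \<and> \<bar>d\<bar> < e \<and> z + d *\<^sub>R i \<in> closure Omega"
  proof cases
    case 1
    then show ?thesis using e xs by (intro exI[of _ "e/2"]) (auto simp: closure_Omega)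
  next
    case 2
    show ?thesis
    proof (cases "s < 1")
      case True
      then show ?thesis using e xs 2
        by (intro exI[of _ "min (e/2) (1 - s)"]) (auto simp: closure_Omega)
    next
      case False
      then show ?thesis using e xs 2
        by (intro exI[of _ "- min (e/2) 1"]) (auto simp: closure_Omega)
    qed
  qed
qed

lemma pdiff_strip:
  assumes f: "(f has_derivative f') (at z within closure Omega)" and z: "z \<in> closure Omega"
  shows "pdiff (closure Omega) b f z = f' b"
proof -
  have "(f has_derivative frechet_derivative f (at z within closure Omega)) (at z within closure Omega)"
    using f frechet_derivative_works differentiable_def by blast
  then show ?thesis
    using has_derivative_unique_strip[OF _ f z] by (simp add: pdiff_def)
qed

lemma has_derivative_cong_within:
  assumes "\<And>w. w \<in> D \<Longrightarrow> f w = g w" "z \<in> D"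
  shows "(f has_derivative f') (at z within D) \<longleftrightarrow> (g has_derivative f') (at z within D)"
  using has_derivative_transform[OF assms(2), of f g] has_derivative_transform[OF assms(2), of g f]
    assms(1) by metis

lemma pdiff_cong:
  assumes "\<And>w. w \<in> D \<Longrightarrow> f w = g w" "z \<in> D"
  shows "pdiff D b f z = pdiff D b g z"
  using has_derivative_cong_within[OF assms] by (simp add: pdiff_def frechet_derivative_def)

text \<open>Derivatives are taken relative to \<open>D\<close>, so the values of a function off \<open>D\<close> have no influence. This
is what allows a partial derivative to be replaced by a formula that agrees with it only on \<open>D\<close>.\<close>

lemma holder_class_cong:
  assumes "\<And>w. w \<in> D \<Longrightarrow> f w = g w"
  shows "holder_class D \<beta> k f \<longleftrightarrow> holder_class D \<beta> k g"
  using assms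
proof (induction k arbitrary: f g)
  case 0
  then have "f ` D = g ` D" by (intro image_cong) auto
  with 0 show ?case by simp
next
  case (Suc k)
  from Suc.prems have "f ` D = g ` D" by (intro image_cong) auto
  moreover have "f differentiable_on D \<longleftrightarrow> g differentiable_on D"
    using has_derivative_cong_within[of D f g] Suc.prems
    by (simp add: differentiable_on_def differentiable_def)
  moreover have "holder_class D \<beta> k (pdiff D b f) \<longleftrightarrow> holder_class D \<beta> k (pdiff D b g)" for b
    using pdiff_cong[of D f g] Suc.prems by (intro Suc.IH) auto
  ultimately show ?case by simp
qed

lemma pdiff_lincomb_strip:
  assumes "f differentiable (at z within closure Omega)" "g differentiable (at z within closure Omega)"
    and "z \<in> closure Omega"
  shows "pdiff (closure Omega) b (\<lambda>w. a * f w + g w) z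
    = a * pdiff (closure Omega) b f z + pdiff (closure Omega) b g z"
proof -
  obtain f' g' where "(f has_derivative f') (at z within closure Omega)"
    "(g has_derivative g') (at z within closure Omega)"
    using assms(1,2) by (auto simp: differentiable_def)
  moreover from this have "((\<lambda>w. a * f w + g w) has_derivative (\<lambda>h. a * f' h + g' h))
      (at z within closure Omega)"
    by (auto intro!: derivative_eq_intros)
  ultimately show ?thesis using assms(3) by (simp add: pdiff_strip)
qed

lemma holder_class_lincomb_strip:
  assumes "holder_class (closure Omega) \<beta> k f" "holder_class (closure Omega) \<beta> k g"
  shows "holder_class (closure Omega) \<beta> k (\<lambda>w. a * f w + g w)"
  using assms
proof (induction k arbitrary: f g)
  case 0
  then obtain C C' where
    C: "\<And>z w. z \<in> closure Omega \<Longrightarrow> w \<in> closure Omega \<Longrightarrow> \<bar>f z - f w\<bar> \<le> C * dist z w powr \<beta>" and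
    C': "\<And>z w. z \<in> closure Omega \<Longrightarrow> w \<in> closure Omega \<Longrightarrow> \<bar>g z - g w\<bar> \<le> C' * dist z w powr \<beta>"
    unfolding holder_class.simps by blast
  have "\<bar>(a * f z + g z) - (a * f w + g w)\<bar> \<le> (\<bar>a\<bar> * C + C') * dist z w powr \<beta>"
    if "z \<in> closure Omega" "w \<in> closure Omega" for z w
  proof -
    have "\<bar>(a * f z + g z) - (a * f w + g w)\<bar> = \<bar>a * (f z - f w) + (g z - g w)\<bar>"
      by (simp add: algebra_simps)
    also have "\<dots> \<le> \<bar>a\<bar> * \<bar>f z - f w\<bar> + \<bar>g z - g w\<bar>" 
      using abs_triangle_ineq[of "a * (f z - f w)" "g z - g w"] by (simp add: abs_mult)
    also have "\<dots> \<le> \<bar>a\<bar> * (C * dist z w powr \<beta>) + C' * dist z w powr \<beta>"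
      using C[OF that] C'[OF that] by (intro add_mono mult_left_mono) auto
    finally show ?thesis by (simp add: algebra_simps)
  qed
  moreover have "bounded ((\<lambda>w. a * f w + g w) ` closure Omega)"
    using bounded_plus_comp[OF bounded_scaleR_comp[of f "closure Omega" a], of g] 0 by simp
  ultimately show ?case unfolding holder_class.simps by blast
next
  case (Suc k)
  have "bounded ((\<lambda>w. a * f w + g w) ` closure Omega)"
    using bounded_plus_comp[OF bounded_scaleR_comp[of f "closure Omega" a], of g] Suc.prems by simp
  moreover have "(\<lambda>w. a * f w + g w) differentiable_on closure Omega"
    using Suc.prems by (auto simp: differentiable_on_def intro!: derivative_intros)
  moreover have "holder_class (closure Omega) \<beta> k (pdiff (closure Omega) b (\<lambda>w. a * f w + g w))"
    if "b \<in> Basis" for b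
  proof -
    have "holder_class (closure Omega) \<beta> k
        (\<lambda>z. a * pdiff (closure Omega) b f z + pdiff (closure Omega) b g z)"
      using Suc.prems that by (intro Suc.IH) auto
    then show ?thesis
      using Suc.prems by (subst holder_class_cong[where g =
            "\<lambda>z. a * pdiff (closure Omega) b f z + pdiff (closure Omega) b g z"])
        (auto intro!: pdiff_lincomb_strip simp: differentiable_on_def)
  qed
  ultimately show ?case by simp
qed

lemma holder_class_zero_strip: "holder_class (closure Omega) \<beta> k (\<lambda>_. 0)"
proof (induction k)
  case 0
  show ?case by (simp add: image_constant_conv, intro impI exI[of _ 0], simp)
next
  case (Suc k)
  have "holder_class (closure Omega) \<beta> k (pdiff (closure Omega) b (\<lambda>_. 0))" for b
    using Suc.IH by (subst holder_class_cong[where g = "\<lambda>_. 0"])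
      (simp_all add: pdiff_strip[OF has_derivative_const])
  then show ?case by (simp add: image_constant_conv)
qed

lemma holder_class_0_imp_continuous_on:
  fixes f :: "'a::euclidean_space \<Rightarrow> real"
  assumes "holder_class D \<beta> 0 f" "\<beta> > 0"
  shows "continuous_on D f"
  unfolding continuous_on_def
proof
  fix z assume z: "z \<in> D"
  obtain C where C: "\<And>z w. z \<in> D \<Longrightarrow> w \<in> D \<Longrightarrow> \<bar>f z - f w\<bar> \<le> C * dist z w powr \<beta>"
    using assms by auto
  have "((\<lambda>w. dist w z powr \<beta>) \<longlongrightarrow> 0 powr \<beta>) (at z within D)"
    using assms(2) by (intro tendsto_powr') (auto intro!: tendsto_eq_intros)
  then have lim: "((\<lambda>w. C * dist w z powr \<beta>) \<longlongrightarrow> 0) (at z within D)"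
    using assms(2) tendsto_mult_right_zero by fastforce
  have "eventually (\<lambda>w. w \<in> D) (at z within D)" by (simp add: eventually_at_filter)
  then have "((\<lambda>w. f w - f z) \<longlongrightarrow> 0) (at z within D)"
    by (intro Lim_null_comparison[OF _ lim]) (auto elim!: eventually_mono intro!: C z)
  then show "(f \<longlongrightarrow> f z) (at z within D)" by (rule Lim_null[THEN iffD2])
qed

lemma has_real_derivative_pdiff_x:
  assumes "f differentiable_on closure Omega" "s \<in> {0..1}"
  shows "((\<lambda>x. f (x, s)) has_real_derivative pdiff (closure Omega) (1, 0) f (x, s)) (at x)"
proof -
  define f' where "f' = frechet_derivative f (at (x, s) within closure Omega)"
  have f': "(f has_derivative f') (at (x, s) within closure Omega)"
    using assms by (auto simp: f'_def differentiable_on_def closure_Omega frechet_derivative_works)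
  have "((\<lambda>x. (x, s)) has_derivative (\<lambda>h. (h, 0))) (at x)"
    by (auto intro!: derivative_eq_intros)
  moreover have "(f has_derivative f') (at (x, s) within range (\<lambda>x. (x, s)))"
    by (rule has_derivative_subset[OF f']) (use assms in \<open>auto simp: closure_Omega\<close>)
  ultimately have "((\<lambda>x. f (x, s)) has_derivative (\<lambda>h. f' (h, 0))) (at x)"
    using has_derivative_in_compose by blast
  moreover have "(\<lambda>h. f' (h, 0)) = (*) (f' (1, 0))"
    using linear_scale[OF has_derivative_linear[OF f'], of _ "(1, 0)"]
    by (intro ext) (metis mult.commute mult.right_neutral mult_zero_right real_scaleR_def scaleR_Pair)
  ultimately show ?thesis by (simp add: has_field_derivative_def pdiff_def f'_def)
qed

lemma has_real_derivative_pdiff_s: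
  assumes "f differentiable_on closure Omega" "s \<in> {0..1}"
  shows "((\<lambda>s. f (x, s)) has_real_derivative pdiff (closure Omega) (0, 1) f (x, s)) (at s within {0..1})"
proof -
  define f' where "f' = frechet_derivative f (at (x, s) within closure Omega)"
  have f': "(f has_derivative f') (at (x, s) within closure Omega)"
    using assms by (auto simp: f'_def differentiable_on_def closure_Omega frechet_derivative_works)
  have "((\<lambda>s. (x, s)) has_derivative (\<lambda>h. (0, h))) (at s within {0..1})"
    by (auto intro!: derivative_eq_intros)
  moreover have "(f has_derivative f') (at (x, s) within (\<lambda>s. (x, s)) ` {0..1})"
    by (rule has_derivative_subset[OF f']) (auto simp: closure_Omega)
  ultimately have "((\<lambda>s. f (x, s)) has_derivative (\<lambda>h. f' (0, h))) (at s within {0..1})"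
    using has_derivative_in_compose by blast
  moreover have "(\<lambda>h. f' (0, h)) = (*) (f' (0, 1))"
    using linear_scale[OF has_derivative_linear[OF f'], of _ "(0, 1)"]
    by (intro ext) (metis mult.commute mult.right_neutral mult_zero_right real_scaleR_def scaleR_Pair)
  ultimately show ?thesis by (simp add: has_field_derivative_def pdiff_def f'_def)
qed

lemma has_derivative_separated:
  assumes C: "(C has_real_derivative c) (at x)"
    and U: "(U has_real_derivative u) (at s within {0..1})"
  shows "((\<lambda>(x, s). C x * U s) has_derivative (\<lambda>(h, k). c * h * U s + C x * (u * k)))
    (at (x, s) within closure Omega)"
proof -
  have "((\<lambda>z. C (fst z)) has_derivative (\<lambda>h. c * fst h)) (at (x, s) within closure Omega)"
    using has_derivative_compose[of fst fst "(x, s)" "closure Omega" C "(*) c"] C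
    by (simp add: has_field_derivative_def has_derivative_fst[OF has_derivative_ident])
  moreover have "((\<lambda>z. U (snd z)) has_derivative (\<lambda>h. u * snd h)) (at (x, s) within closure Omega)"
  proof -
    have "(U has_derivative (*) u) (at (snd (x, s)) within snd ` closure Omega)"
      using U by (simp add: has_field_derivative_def closure_Omega)
    then show ?thesis
      using has_derivative_in_compose[of snd snd "(x, s)" "closure Omega" U "(*) u"]
      by (simp add: has_derivative_snd[OF has_derivative_ident])
  qed
  ultimately have "((\<lambda>z. C (fst z) * U (snd z)) has_derivative
      (\<lambda>h. C x * (u * snd h) + c * fst h * U s)) (at (x, s) within closure Omega)"
    by (auto intro!: derivative_eq_intros)
  then show ?thesis by (simp add: case_prod_beta' add.commute)
qed

lemma
  assumes "(C has_real_derivative c) (at x)" "(U has_real_derivative u) (at s within {0..1})"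
    "s \<in> {0..1}"
  shows pdiff_x_separated: "pdiff (closure Omega) (1, 0) (\<lambda>(x, s). C x * U s) (x, s) = c * U s"
    and pdiff_s_separated: "pdiff (closure Omega) (0, 1) (\<lambda>(x, s). C x * U s) (x, s) = C x * u"
  using pdiff_strip[OF has_derivative_separated[OF assms(1,2)]] assms(3)
  by (simp_all add: closure_Omega)

text \<open>Points at distance at most one use the Lipschitz bound, and points farther apart the bound on the values.\<close>

lemma bounded_lipschitz_imp_holder:
  fixes f :: "'a::euclidean_space \<Rightarrow> real"
  assumes "bounded (f ` D)" "L-lipschitz_on D f" "0 < \<beta>" "\<beta> \<le> 1"
  shows "holder_class D \<beta> 0 f"
proof -
  obtain B where B: "\<And>z. z \<in> D \<Longrightarrow> \<bar>f z\<bar> \<le> B" using assms(1) by (auto simp: bounded_iff)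
  have L: "L \<ge> 0" "\<And>z w. z \<in> D \<Longrightarrow> w \<in> D \<Longrightarrow> \<bar>f z - f w\<bar> \<le> L * dist z w"
    using assms(2) by (auto simp: lipschitz_on_def dist_real_def)
  have "\<bar>f z - f w\<bar> \<le> (L + 2 * B) * dist z w powr \<beta>" if zw: "z \<in> D" "w \<in> D" for z w
  proof (cases "dist z w \<le> 1")
    case True
    have "dist z w = dist z w powr 1" by simp
    also have "\<dots> \<le> dist z w powr \<beta>" using True assms(4) by (intro powr_mono') auto
    finally have "L * dist z w \<le> L * dist z w powr \<beta>" using L(1) by (intro mult_left_mono)
    moreover have "0 \<le> 2 * B * dist z w powr \<beta>" using B[OF zw(1)] by (intro mult_nonneg_nonneg) auto
    ultimately show ?thesis using L(2)[OF zw] by (simp add: algebra_simps)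
  next
    case False
    then have "1 \<le> dist z w powr \<beta>" using assms(3) by (intro ge_one_powr_ge_zero) auto
    then have "2 * B * 1 \<le> 2 * B * dist z w powr \<beta>" using B[OF zw(1)] by (intro mult_left_mono) auto
    moreover have "0 \<le> L * dist z w powr \<beta>" using L(1) by simp
    ultimately show ?thesis using B[OF zw(1)] B[OF zw(2)] by (simp add: algebra_simps)
  qed
  then show ?thesis using assms(1) by auto
qed

lemma bounded_separated:
  fixes C U :: "real \<Rightarrow> real"
  assumes "bounded (range C)" "bounded (U ` {0..1})"
  shows "bounded ((\<lambda>(x, s). C x * U s) ` closure Omega)"
proof -
  obtain B where "\<And>x. \<bar>C x\<bar> \<le> B"
    using assms(1) by (auto simp: bounded_iff)
  moreover obtain B' where "\<And>s. s \<in> {0..1} \<Longrightarrow> \<bar>U s\<bar> \<le> B'"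
    using assms(2) unfolding bounded_iff by (metis imageI real_norm_def)
  ultimately have "\<bar>C x * U s\<bar> \<le> B * B'" if "s \<in> {0..1}" for x s
    unfolding abs_mult using that by (intro mult_mono) (auto intro: order_trans[OF abs_ge_zero])
  then show ?thesis by (auto simp: bounded_iff closure_Omega intro!: exI[of _ "B * B'"])
qed

lemma holder_class_0_separated:
  fixes C U :: "real \<Rightarrow> real"
  assumes C: "bounded (range C)" "L-lipschitz_on UNIV C"
    and U: "bounded (U ` {0..1})" "L'-lipschitz_on {0..1} U" and "0 < \<beta>" "\<beta> \<le> 1"
  shows "holder_class (closure Omega) \<beta> 0 (\<lambda>(x, s). C x * U s)"
proof -
  obtain B where B: "\<And>x. \<bar>C x\<bar> \<le> B"
    using C(1) by (auto simp: bounded_iff)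
  obtain B' where B': "\<And>s. s \<in> {0..1} \<Longrightarrow> \<bar>U s\<bar> \<le> B'"
    using U(1) unfolding bounded_iff by (metis imageI real_norm_def)
  have pos: "0 \<le> B" "0 \<le> B'" "0 \<le> L" "0 \<le> L'"
    using B[of 0] B'[of 0] C(2) U(2) by (auto simp: lipschitz_on_def)
  have "\<bar>C x * U s - C y * U t\<bar> \<le> (L * B' + B * L') * dist (x, s) (y, t)"
    if st: "s \<in> {0..1}" "t \<in> {0..1}" for x s y t
  proof -
    have d: "dist x y \<le> dist (x, s) (y, t)" "dist s t \<le> dist (x, s) (y, t)"
      using dist_fst_le[of "(x, s)" "(y, t)"] dist_snd_le[of "(x, s)" "(y, t)"] by auto
    have "\<bar>C x - C y\<bar> \<le> L * dist (x, s) (y, t)"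
      using lipschitz_onD[OF C(2), of x y] mult_left_mono[OF d(1) pos(3)] by (simp add: dist_real_def)
    moreover have "\<bar>U s - U t\<bar> \<le> L' * dist (x, s) (y, t)"
      using lipschitz_onD[OF U(2) st] mult_left_mono[OF d(2) pos(4)] by (simp add: dist_real_def)
    ultimately have "\<bar>C x - C y\<bar> * \<bar>U s\<bar> + \<bar>C y\<bar> * \<bar>U s - U t\<bar>
        \<le> (L * dist (x, s) (y, t)) * B' + B * (L' * dist (x, s) (y, t))"
      using B B' st pos by (intro add_mono mult_mono) auto
    moreover have "C x * U s - C y * U t = (C x - C y) * U s + C y * (U s - U t)"
      by (simp add: algebra_simps)
    then have "\<bar>C x * U s - C y * U t\<bar> \<le> \<bar>C x - C y\<bar> * \<bar>U s\<bar> + \<bar>C y\<bar> * \<bar>U s - U t\<bar>"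
      by (metis abs_mult abs_triangle_ineq)
    ultimately show ?thesis by (simp add: algebra_simps)
  qed
  then have "(L * B' + B * L')-lipschitz_on (closure Omega) (\<lambda>(x, s). C x * U s)"
    using pos by (auto simp: lipschitz_on_def closure_Omega dist_real_def)
  then show ?thesis
    using bounded_lipschitz_imp_holder[OF bounded_separated[OF C(1) U(1)]] assms by blast
qed

text \<open>Differentiating a product \<open>C(x) U(s)\<close> again gives a product, so both orders of differentiation are
instances of the same step and everything reduces to the six one-dimensional factors.\<close>

lemma holder_class_2_separated:
  fixes C U :: "real \<Rightarrow> real"
  assumes C: "\<And>x. (C has_real_derivative C1 x) (at x)" "\<And>x. (C1 has_real_derivative C2 x) (at x)"
    and U: "\<And>s. s \<in> {0..1} \<Longrightarrow> (U has_real_derivative U1 s) (at s within {0..1})"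
      "\<And>s. s \<in> {0..1} \<Longrightarrow> (U1 has_real_derivative U2 s) (at s within {0..1})"
    and bdC: "bounded (range C)" "bounded (range C1)" "bounded (range C2)"
    and bdU: "bounded (U ` {0..1})" "bounded (U1 ` {0..1})" "bounded (U2 ` {0..1})"
    and lipC: "A-lipschitz_on UNIV C" "A1-lipschitz_on UNIV C1" "A2-lipschitz_on UNIV C2"
    and lipU: "K-lipschitz_on {0..1} U" "K1-lipschitz_on {0..1} U1" "K2-lipschitz_on {0..1} U2"
    and \<beta>: "0 < \<beta>" "\<beta> \<le> 1"
  shows "holder_class (closure Omega) \<beta> 2 (\<lambda>(x, s). C x * U s)"
proof -
  let ?D = "closure Omega"
  have step: "holder_class ?D \<beta> (Suc k) (\<lambda>(x, s). C x * U s)"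
    if C: "\<And>x. (C has_real_derivative C1 x) (at x)"
    and U: "\<And>s. s \<in> {0..1} \<Longrightarrow> (U has_real_derivative U1 s) (at s within {0..1})"
    and bd: "bounded (range C)" "bounded (U ` {0..1})"
    and H: "holder_class ?D \<beta> k (\<lambda>(x, s). C1 x * U s)" "holder_class ?D \<beta> k (\<lambda>(x, s). C x * U1 s)"
    for C C1 U U1 k
  proof -
    have "(\<lambda>(x, s). C x * U s) differentiable_on ?D"
      using has_derivative_separated[OF C U] 
      by (fastforce simp: differentiable_on_def differentiable_def closure_Omega)
    moreover have "holder_class ?D \<beta> k (pdiff ?D (1, 0) (\<lambda>(x, s). C x * U s))"
      using H(1) pdiff_x_separated[OF C U]
      by (subst holder_class_cong[where g = "\<lambda>(x, s). C1 x * U s"]) (auto simp: closure_Omega)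
    moreover have "holder_class ?D \<beta> k (pdiff ?D (0, 1) (\<lambda>(x, s). C x * U s))"
      using H(2) pdiff_s_separated[OF C U]
      by (subst holder_class_cong[where g = "\<lambda>(x, s). C x * U1 s"]) (auto simp: closure_Omega)
    ultimately show ?thesis
      using bounded_separated[OF bd] by (auto simp: Basis_prod_def)
  qed
  have "holder_class ?D \<beta> (Suc (Suc 0)) (\<lambda>(x, s). C x * U s)"
    by (rule step[OF C(1) U(1) bdC(1) bdU(1)
          step[OF C(2) U(1) bdC(2) bdU(1)
            holder_class_0_separated[OF bdC(3) lipC(3) bdU(1) lipU(1) \<beta>]
            holder_class_0_separated[OF bdC(2) lipC(2) bdU(2) lipU(2) \<beta>]]
          step[OF C(1) U(2) bdC(1) bdU(2)
            holder_class_0_separated[OF bdC(2) lipC(2) bdU(2) lipU(2) \<beta>]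
            holder_class_0_separated[OF bdC(1) lipC(1) bdU(3) lipU(3) \<beta>]]])
  then show ?thesis by (simp add: numeral_2_eq_2)
qed

section \<open>The cosine system on a half period\<close>

text \<open>The claim is stronger than the vanishing of the integrals against powers of the cosine, so that the induction
closes: multiplication by \<open>cos (\<kappa> * x)\<close> sends the frequency \<open>n\<close> to the average of the frequencies
\<open>n + 1\<close> and \<open>n - 1\<close>.\<close>

lemma integral_mult_cos_power_eq_0:
  fixes f :: "real \<Rightarrow> real"
  assumes cont: "continuous_on {a..b} f"
    and zero: "\<And>n. integral {a..b} (\<lambda>x. f x * cos (real n * \<kappa> * x)) = 0"
  shows "integral {a..b} (\<lambda>x. f x * cos (\<kappa> * x) ^ k * cos (real n * \<kappa> * x)) = 0"
proof (induction k arbitrary: n)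
  case 0
  then show ?case using zero by simp
next
  case (Suc k)
  have int: "(\<lambda>x. f x * cos (\<kappa> * x) ^ k * cos (real m * \<kappa> * x)) integrable_on {a..b}" for m
    by (intro integrable_continuous_real continuous_intros cont)
  show ?case
  proof (cases n)
    case 0
    then show ?thesis using Suc.IH[of 1] by (simp add: mult_ac)
  next
    case (Suc m)
    have "f x * cos (\<kappa> * x) ^ Suc k * cos (real n * \<kappa> * x)
      = (f x * cos (\<kappa> * x) ^ k * cos (real (Suc n) * \<kappa> * x)
        + f x * cos (\<kappa> * x) ^ k * cos (real m * \<kappa> * x)) / 2" for x
    proof -
      have "real (Suc n) * \<kappa> * x = real n * \<kappa> * x + \<kappa> * x" "real m * \<kappa> * x = real n * \<kappa> * x - \<kappa> * x"
        using Suc by (simp_all add: algebra_simps)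
      then have "cos (\<kappa> * x) * cos (real n * \<kappa> * x)
          = (cos (real (Suc n) * \<kappa> * x) + cos (real m * \<kappa> * x)) / 2"
        by (simp only: cos_add cos_diff) simp
      then have "f x * cos (\<kappa> * x) ^ k * (cos (\<kappa> * x) * cos (real n * \<kappa> * x))
          = f x * cos (\<kappa> * x) ^ k * ((cos (real (Suc n) * \<kappa> * x) + cos (real m * \<kappa> * x)) / 2)"
        by (simp only:)
      then show ?thesis by (simp add: algebra_simps)
    qed
    moreover have "integral {a..b} (\<lambda>x. (f x * cos (\<kappa> * x) ^ k * cos (real (Suc n) * \<kappa> * x)
        + f x * cos (\<kappa> * x) ^ k * cos (real m * \<kappa> * x)) / 2) = 0"
      by (simp only: integral_divide integral_add[OF int int] Suc.IH) simp
    ultimately show ?thesis by (simp only:)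
  qed
qed

text \<open>On the half period the map \<open>x \<mapsto> cos (\<kappa> * x)\<close> is a homeomorphism onto \<open>[-1, 1]\<close>, so by Weierstrass \<open>f\<close> is a
uniform limit of polynomials in \<open>cos (\<kappa> * x)\<close>. As \<open>f\<close> is orthogonal to all of these, it is
orthogonal to itself.\<close>

lemma cosine_system_complete:
  fixes f :: "real \<Rightarrow> real"
  assumes \<kappa>: "\<kappa> > 0" and cont: "continuous_on {0..pi / \<kappa>} f"
    and zero: "\<And>n. integral {0..pi / \<kappa>} (\<lambda>x. f x * cos (real n * \<kappa> * x)) = 0"
    and x: "x \<in> {0..pi / \<kappa>}"
  shows "f x = 0"
proof -
  let ?I = "{0..pi / \<kappa>}"
  have \<kappa>x: "0 \<le> \<kappa> * x" "\<kappa> * x \<le> pi" if "x \<in> ?I" for x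
    using that \<kappa> by (auto simp: field_simps)
  have poly: "integral ?I (\<lambda>x. f x * p (cos (\<kappa> * x))) = 0" if p: "real_polynomial_function p" for p
  proof -
    obtain a n where p: "p = (\<lambda>y. \<Sum>i\<le>n. a i * y ^ i)"
      using p by (auto simp: real_polynomial_function_iff_sum)
    have "integral ?I (\<lambda>x. f x * p (cos (\<kappa> * x)))
        = integral ?I (\<lambda>x. \<Sum>i\<le>n. a i * (f x * cos (\<kappa> * x) ^ i))"
      by (simp add: p sum_distrib_left mult_ac)
    also have "\<dots> = (\<Sum>i\<le>n. integral ?I (\<lambda>x. a i * (f x * cos (\<kappa> * x) ^ i)))"
      by (intro integral_sum integrable_continuous_real continuous_intros cont) auto
    also have "\<dots> = (\<Sum>i\<le>n. a i * integral ?I (\<lambda>x. f x * cos (\<kappa> * x) ^ i))" by simp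
    also have "\<dots> = 0"
      using integral_mult_cos_power_eq_0[OF cont zero, of _ 0] by simp
    finally show ?thesis .
  qed
  define A where "A = integral ?I (\<lambda>x. \<bar>f x\<bar>)"
  have f2_int: "(\<lambda>x. (f x)\<^sup>2) integrable_on ?I" and A_int: "(\<lambda>x. \<bar>f x\<bar>) integrable_on ?I"
    by (intro integrable_continuous_real continuous_intros cont)+
  have A: "A \<ge> 0" unfolding A_def by (intro integral_nonneg A_int) auto
  have "integral ?I (\<lambda>x. (f x)\<^sup>2) \<le> e * A" if e: "e > 0" for e
  proof -
    have "continuous_on {-1..1} (\<lambda>y. f (arccos y / \<kappa>))"
      using \<kappa> by (intro continuous_on_compose2[OF cont] continuous_intros)
        (auto simp: arccos_lbound arccos_ubound divide_right_mono)
    then obtain p where p: "real_polynomial_function p"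
      "\<And>y. y \<in> {-1..1} \<Longrightarrow> \<bar>f (arccos y / \<kappa>) - p y\<bar> < e"
      using Stone_Weierstrass_real_polynomial_function[OF compact_Icc _ e] by blast
    have close: "\<bar>f x - p (cos (\<kappa> * x))\<bar> < e" if "x \<in> ?I" for x
      using p(2)[of "cos (\<kappa> * x)"] \<kappa> \<kappa>x[OF that] by (simp add: arccos_cos)
    have p_cont: "continuous_on ?I (\<lambda>x. p (cos (\<kappa> * x)))"
      by (intro continuous_on_compose2[OF continuous_on_polymonial_function[of p UNIV]] continuous_intros)
        (use p(1) in \<open>auto simp: real_polynomial_function_eq\<close>)
    have int: "(\<lambda>x. f x * p (cos (\<kappa> * x))) integrable_on ?I"
      by (intro integrable_continuous_real continuous_intros cont p_cont)
    have "integral ?I (\<lambda>x. (f x)\<^sup>2) = integral ?I (\<lambda>x. (f x)\<^sup>2) - integral ?I (\<lambda>x. f x * p (cos (\<kappa> * x)))"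
      using poly[OF p(1)] by simp
    also have "\<dots> = integral ?I (\<lambda>x. (f x)\<^sup>2 - f x * p (cos (\<kappa> * x)))"
      by (rule Henstock_Kurzweil_Integration.integral_diff[OF f2_int int, symmetric])
    also have "\<dots> \<le> integral ?I (\<lambda>x. e * \<bar>f x\<bar>)"
    proof (rule integral_le)
      show "(\<lambda>x. (f x)\<^sup>2 - f x * p (cos (\<kappa> * x))) integrable_on ?I"
        by (intro integrable_diff f2_int int)
      show "(\<lambda>x. e * \<bar>f x\<bar>) integrable_on ?I"
        by (intro integrable_continuous_real continuous_intros cont)
      fix x assume "x \<in> ?I"
      have "(f x)\<^sup>2 - f x * p (cos (\<kappa> * x)) = f x * (f x - p (cos (\<kappa> * x)))"
        by (simp add: power2_eq_square algebra_simps)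
      also have "\<dots> \<le> \<bar>f x\<bar> * \<bar>f x - p (cos (\<kappa> * x))\<bar>" by (metis abs_ge_self abs_mult)
      also have "\<dots> \<le> \<bar>f x\<bar> * e" using close[OF \<open>x \<in> ?I\<close>] by (intro mult_left_mono) auto
      finally show "(f x)\<^sup>2 - f x * p (cos (\<kappa> * x)) \<le> e * \<bar>f x\<bar>" by (simp add: mult.commute)
    qed
    also have "\<dots> = e * A" by (simp add: A_def)
    finally show ?thesis .
  qed
  note bound = this
  have "integral ?I (\<lambda>x. (f x)\<^sup>2) \<le> 0 + e" if e: "e > 0" for e
  proof -
    \<comment> \<open>The denominator \<open>A + 1\<close> covers the case that \<open>A\<close> vanishes.\<close>
    have "integral ?I (\<lambda>x. (f x)\<^sup>2) \<le> e / (A + 1) * A" using e A by (intro bound) simp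
    also have "\<dots> \<le> e" using e A by (simp add: field_simps)
    finally show ?thesis by simp
  qed
  then have "integral ?I (\<lambda>x. (f x)\<^sup>2) \<le> 0" by (rule field_le_epsilon)
  moreover have "integral ?I (\<lambda>x. (f x)\<^sup>2) \<ge> 0" by (intro integral_nonneg f2_int) auto
  ultimately have "integral ?I (\<lambda>x. (f x)\<^sup>2) = 0" by simp
  then have "\<forall>x\<in>?I. (f x)\<^sup>2 = 0"
    using \<kappa> by (subst (asm) integral_eq_0_iff) (auto intro!: continuous_intros cont)
  with x show ?thesis by simp
qed

lemma cosine_system_orthogonal:
  assumes "\<kappa> > 0" "m \<noteq> n"
  shows "integral {0..pi / \<kappa>} (\<lambda>x. cos (real m * \<kappa> * x) * cos (real n * \<kappa> * x)) = 0"
proof -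
  define i j where "i = real_of_int (int m + int n)" and "j = real_of_int (int m - int n)"
  have ij: "i \<noteq> 0" "j \<noteq> 0" using assms by (auto simp: i_def j_def)
  \<comment> \<open>An antiderivative, by the product formula for cosines; it vanishes at both end points.\<close>
  define F where "F x = sin (i * \<kappa> * x) / (2 * i * \<kappa>) + sin (j * \<kappa> * x) / (2 * j * \<kappa>)" for x
  have F: "F (pi / \<kappa>) = 0" "F 0 = 0"
  proof -
    have "i * \<kappa> * (pi / \<kappa>) = pi * i" "j * \<kappa> * (pi / \<kappa>) = pi * j" using assms by simp_all
    moreover have "sin (pi * i) = 0" "sin (pi * j) = 0" by (simp_all only: i_def j_def sin_npi_int)
    ultimately show "F (pi / \<kappa>) = 0" by (simp only: F_def div_0 add_0)
  qed (simp add: F_def)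
  have "((\<lambda>x. cos (real m * \<kappa> * x) * cos (real n * \<kappa> * x)) has_integral (F (pi / \<kappa>) - F 0)) {0..pi / \<kappa>}"
  proof (rule fundamental_theorem_of_calculus)
    fix x
    have "(F has_real_derivative (cos (i * \<kappa> * x) + cos (j * \<kappa> * x)) / 2) (at x within {0..pi / \<kappa>})"
      unfolding F_def[abs_def] using ij assms
      by (auto intro!: derivative_eq_intros simp: field_simps)
    moreover have "i * \<kappa> * x = real m * \<kappa> * x + real n * \<kappa> * x" "j * \<kappa> * x = real m * \<kappa> * x - real n * \<kappa> * x"
      by (simp_all add: i_def j_def algebra_simps)
    then have "(cos (i * \<kappa> * x) + cos (j * \<kappa> * x)) / 2 = cos (real m * \<kappa> * x) * cos (real n * \<kappa> * x)"
      by (simp only: cos_add cos_diff) simp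
    ultimately show "(F has_vector_derivative cos (real m * \<kappa> * x) * cos (real n * \<kappa> * x)) (at x within {0..pi / \<kappa>})"
      by (simp add: has_real_derivative_iff_has_vector_derivative)
  qed (use assms in auto)
  then show ?thesis using F by (simp add: integral_unique)
qed

lemma cosine_system_norm_neq_0:
  assumes "\<kappa> > 0"
  shows "integral {0..pi / \<kappa>} (\<lambda>x. cos (real n * \<kappa> * x) * cos (real n * \<kappa> * x)) \<noteq> 0"
proof
  assume "integral {0..pi / \<kappa>} (\<lambda>x. cos (real n * \<kappa> * x) * cos (real n * \<kappa> * x)) = 0"
  then have "\<forall>x\<in>{0..pi / \<kappa>}. cos (real n * \<kappa> * x) * cos (real n * \<kappa> * x) = 0"
    using assms by (subst (asm) integral_eq_0_iff) (auto intro!: continuous_intros)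
  then have "cos (real n * \<kappa> * 0) * cos (real n * \<kappa> * 0) = 0"
    using assms by (metis atLeastAtMost_iff order_refl pi_ge_zero divide_nonneg_pos)
  then show False by simp
qed

lemma periodic_even_zero:
  fixes f :: "real \<Rightarrow> real"
  assumes T: "T > 0" and per: "\<And>x. f (x + 2 * T) = f x" and even: "\<And>x. f (- x) = f x"
    and zero: "\<And>x. x \<in> {0..T} \<Longrightarrow> f x = 0"
  shows "f x = 0"
proof -
  have shift: "f (y + real k * (2 * T)) = f y" for y and k :: nat
  proof (induction k)
    case (Suc k)
    have "y + real (Suc k) * (2 * T) = (y + real k * (2 * T)) + 2 * T" by (simp add: algebra_simps)
    then show ?case using per Suc by metis
  qed simp
  have nonneg: "f x = 0" if x: "x \<ge> 0" for x
  proof -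
    define k where "k = nat \<lfloor>x / (2 * T)\<rfloor>"
    define y where "y = x - real k * (2 * T)"
    have "real k = of_int \<lfloor>x / (2 * T)\<rfloor>" using x T by (simp add: k_def)
    then have "real k \<le> x / (2 * T)" "x / (2 * T) < real k + 1" by linarith+
    then have y: "0 \<le> y" "y < 2 * T" using T by (auto simp: y_def field_simps)
    have "f y = 0"
    proof (cases "y \<le> T")
      case True
      then show ?thesis using y zero by simp
    next
      case False
      have "f y = f (- y + 2 * T)" using per[of "- y"] even[of y] by simp
      then show ?thesis using False y zero[of "- y + 2 * T"] by simp
    qed
    then show ?thesis using shift[of y k] by (simp add: y_def)
  qed
  show ?thesis using nonneg[of x] nonneg[of "- x"] even[of x] by (cases "x \<ge> 0") auto
qed

text \<open>An even function of period \<open>2 T\<close> is symmetric about both \<open>0\<close> and \<open>T\<close>. The lemma removes the boundary terms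
at both ends of the half period when integrating by parts.\<close>

lemma reflection_symmetric_deriv_eq_0:
  fixes f :: "real \<Rightarrow> real"
  assumes "\<And>x. f (2 * c - x) = f x" "(f has_real_derivative d) (at c)"
  shows "d = 0"
proof -
  have "((\<lambda>x. f (2 * c - x)) has_real_derivative d * (- 1)) (at c)"
    by (rule DERIV_chain2[where f = f]) (use assms(2) in \<open>auto intro!: derivative_eq_intros\<close>)
  then have "(f has_real_derivative - d) (at c)" by (simp add: assms(1))
  from DERIV_unique[OF assms(2) this] show ?thesis by simp
qed

section \<open>Modes of the linearised problem\<close>

lemma lipschitz_on_unit_interval_C1:
  fixes f :: "real \<Rightarrow> real"
  assumes f: "\<And>s. s \<in> {0..1} \<Longrightarrow> (f has_real_derivative f' s) (at s within {0..1})"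
    and cont: "continuous_on {0..1} f'"
  obtains L where "L-lipschitz_on {0..1} f"
proof -
  have "bounded (f' ` {0..1})"
    by (intro compact_imp_bounded compact_continuous_image cont compact_Icc)
  then obtain B where B: "\<And>s. s \<in> {0..1} \<Longrightarrow> \<bar>f' s\<bar> \<le> B"
    unfolding bounded_iff by (metis imageI real_norm_def)
  have "B-lipschitz_on {0..1} f"
  proof (rule lipschitz_onI)
    fix s t :: real assume st: "s \<in> {0..1}" "t \<in> {0..1}"
    show "dist (f s) (f t) \<le> B * dist s t"
      using field_differentiable_bound[of "{0..1}" f f' B s t] f B st
      by (simp add: dist_norm norm_minus_commute)
  next
    show "0 \<le> B" using B[of 0] by simp
  qed
  then show ?thesis by (rule that)
qed

lemma lipschitz_on_scaled_trig:
  fixes a c :: real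
  shows "\<bar>a * c\<bar>-lipschitz_on UNIV (\<lambda>x. c * cos (a * x))"
    and "\<bar>a * c\<bar>-lipschitz_on UNIV (\<lambda>x. c * sin (a * x))"
proof -
  have bd: "\<bar>a * c * cos y\<bar> \<le> \<bar>a * c\<bar>" "\<bar>a * c * sin y\<bar> \<le> \<bar>a * c\<bar>" for y
    using mult_left_mono[of "\<bar>cos y\<bar>" 1 "\<bar>a * c\<bar>"] mult_left_mono[of "\<bar>sin y\<bar>" 1 "\<bar>a * c\<bar>"]
    by (simp_all add: abs_mult)
  have "norm (c * cos (a * x) - c * cos (a * y)) \<le> \<bar>a * c\<bar> * norm (x - y)" for x y
    by (rule field_differentiable_bound[of UNIV _ "\<lambda>x. - (a * c * sin (a * x))"])
      (use bd in \<open>auto intro!: derivative_eq_intros\<close>)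
  then show "\<bar>a * c\<bar>-lipschitz_on UNIV (\<lambda>x. c * cos (a * x))"
    by (intro lipschitz_onI) (simp_all add: dist_norm)
  have "norm (c * sin (a * x) - c * sin (a * y)) \<le> \<bar>a * c\<bar> * norm (x - y)" for x y
    by (rule field_differentiable_bound[of UNIV _ "\<lambda>x. a * c * cos (a * x)"])
      (use bd in \<open>auto intro!: derivative_eq_intros\<close>)
  then show "\<bar>a * c\<bar>-lipschitz_on UNIV (\<lambda>x. c * sin (a * x))"
    by (intro lipschitz_onI) (simp_all add: dist_norm)
qed

lemma bounded_range_scaled_trig:
  fixes a c :: real
  shows "bounded (range (\<lambda>x. c * cos (a * x)))" "bounded (range (\<lambda>x. c * sin (a * x)))"
proof -
  have "\<bar>c * cos y\<bar> \<le> \<bar>c\<bar>" "\<bar>c * sin y\<bar> \<le> \<bar>c\<bar>" for y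
    using mult_left_mono[of "\<bar>cos y\<bar>" 1 "\<bar>c\<bar>"] mult_left_mono[of "\<bar>sin y\<bar>" 1 "\<bar>c\<bar>"]
    by (simp_all add: abs_mult)
  then show "bounded (range (\<lambda>x. c * cos (a * x)))" "bounded (range (\<lambda>x. c * sin (a * x)))"
    by (auto simp: bounded_iff)
qed

lemma has_real_derivative_unique_unit_interval:
  fixes f :: "real \<Rightarrow> real"
  assumes "(f has_real_derivative d) (at s within {0..1})"
    "(f has_real_derivative d') (at s within {0..1})" "s \<in> {0..1}"
  shows "d = d'"
  using vector_derivative_unique_within_closed_interval[of 0 1 s f d d'] assms
  by (simp add: has_real_derivative_iff_has_vector_derivative)

locale linearised_problem =
  fixes \<gamma> :: "real \<Rightarrow> real" and \<mu> lam :: real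
  assumes analytic: "real_analytic \<gamma>" and bounded_deriv: "bounded (range (deriv \<gamma>))"
    and lam: "lam \<noteq> 0"
begin

definition q :: "real \<Rightarrow> real" where
  "q s = deriv \<gamma> (psi_bar \<gamma> \<mu> lam s)"

definition u :: "real \<Rightarrow> real \<Rightarrow> real" where
  "u z = u_sol \<gamma> \<mu> lam z"

definition u' :: "real \<Rightarrow> real \<Rightarrow> real" where
  "u' z s = vector_derivative (u z) (at s within {0..1})"

lemma u_facts:
  shows u_0: "u z 0 = 0" and u'_0: "u' z 0 = 1"
    and u_deriv: "\<And>s. s \<in> {0..1} \<Longrightarrow> (u z has_real_derivative u' z s) (at s within {0..1})"
    and u'_deriv: "\<And>s. s \<in> {0..1} \<Longrightarrow>
      (u' z has_real_derivative - (q s - z) * u z s) (at s within {0..1})"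
    and u_outside: "\<And>s. s \<notin> {0..1} \<Longrightarrow> u z s = 0"
proof -
  have "ivp_solution (\<lambda>s y. - (q s - z) * y) 0 0 1 (u z)"
    unfolding u_def q_def by (rule ivp_solution_u_sol[OF analytic bounded_deriv])
  then obtain v where v: "u z 0 = 0" "v 0 = 1"
    "\<And>s. s \<in> {0..1} \<Longrightarrow> (u z has_real_derivative v s) (at s within {0..1})"
    "\<And>s. s \<in> {0..1} \<Longrightarrow> (v has_real_derivative - (q s - z) * u z s) (at s within {0..1})"
    "\<And>s. s \<notin> {0..1} \<Longrightarrow> u z s = 0"
    by (rule ivp_solutionE) blast
  have u'_eq: "u' z s = v s" if "s \<in> {0..1}" for s
    unfolding u'_def using v(3)[OF that] that
    by (intro vector_derivative_within_closed_interval[of 0 1])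
      (simp_all add: has_real_derivative_iff_has_vector_derivative)
  show "u z 0 = 0" "u' z 0 = 1" "\<And>s. s \<notin> {0..1} \<Longrightarrow> u z s = 0" using v u'_eq by auto
  show "(u z has_real_derivative u' z s) (at s within {0..1})" if "s \<in> {0..1}" for s
    using v(3) u'_eq that by simp
  show "(u' z has_real_derivative - (q s - z) * u z s) (at s within {0..1})" if "s \<in> {0..1}" for s
    by (rule has_field_derivative_transform_within[OF v(4)[OF that] zero_less_one that])
      (simp add: u'_eq)
qed

text \<open>Data at \<open>0\<close> identify the cosine coefficients of a kernel element, and data at \<open>1\<close> show that a nontrivial
solution cannot have vanishing Cauchy data at the surface.\<close>

lemma linear_ivp_unique:
  assumes t: "t = 0 \<or> t = 1"
    and y: "\<And>s. s \<in> {0..1} \<Longrightarrow> (y has_real_derivative v s) (at s within {0..1})"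
      "\<And>s. s \<in> {0..1} \<Longrightarrow> (v has_real_derivative - (q s - z) * y s) (at s within {0..1})"
    and y': "\<And>s. s \<in> {0..1} \<Longrightarrow> (y' has_real_derivative v' s) (at s within {0..1})"
      "\<And>s. s \<in> {0..1} \<Longrightarrow> (v' has_real_derivative - (q s - z) * y' s) (at s within {0..1})"
    and init: "y t = y' t" "v t = v' t"
    and s: "s \<in> {0..1}"
  shows "y s = y' s" "v s = v' s"
proof -
  let ?cut = "\<lambda>y s. if s \<in> {0..1::real} then y s else (0::real)"
  have "ivp_solution (\<lambda>s y. - (q s - z) * y) t (y t) (v t) (?cut y)"
    if "\<And>s. s \<in> {0..1} \<Longrightarrow> (y has_real_derivative v s) (at s within {0..1})"
      "\<And>s. s \<in> {0..1} \<Longrightarrow> (v has_real_derivative - (q s - z) * y s) (at s within {0..1})" for y v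
    unfolding ivp_solution_def
  proof (intro exI[of _ v] conjI ballI allI impI)
    show "?cut y t = y t" using t by auto
    fix s :: real assume s: "s \<in> {0..1}"
    show "(?cut y has_real_derivative v s) (at s within {0..1})"
      by (rule has_field_derivative_transform_within[OF that(1)[OF s] zero_less_one s]) simp
    show "(v has_real_derivative - (q s - z) * ?cut y s) (at s within {0..1})"
      using that(2)[OF s] s by simp
  qed auto
  from this[OF y] this[OF y'] init
  have "ivp_solution (\<lambda>s y. - (q s - z) * y) t (y t) (v t) (?cut y)"
    "ivp_solution (\<lambda>s y. - (q s - z) * y) t (y t) (v t) (?cut y')" by simp_all
  then have "?cut y = ?cut y'"
    using linear_ivp_ex1[OF analytic bounded_deriv t, of \<mu> lam z "y t" "v t"]
    unfolding q_def by blast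
  then have eq: "y r = y' r" if "r \<in> {0..1}" for r
    using that by (metis (no_types, lifting))
  then show "y s = y' s" using s by blast
  have "(y has_real_derivative v' s) (at s within {0..1})"
    by (rule has_field_derivative_transform_within[OF y'(1)[OF s] zero_less_one s]) (simp add: eq)
  then show "v s = v' s" using has_real_derivative_unique_unit_interval y(1)[OF s] s by blast
qed

lemma u_u'_not_both_0:
  assumes "u z 1 = 0" shows "u' z 1 \<noteq> 0"
proof
  assume "u' z 1 = 0"
  then have "u' z 0 = 0"
    using linear_ivp_unique(2)[where t = 1 and z = z and y = "u z" and v = "u' z"
        and y' = "\<lambda>_. 0" and v' = "\<lambda>_. 0" and s = 0, OF _ u_deriv u'_deriv] assms by simp
  then show False by (simp add: u'_0)
qed

text \<open>The kernel equation without the quotient. The equation on the right excludes poles by itself: if \<open>u\<close> vanished at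
\<open>1\<close>, it would force the derivative to vanish there too.\<close>

lemma kernel_equation_iff:
  "kernel_equation \<gamma> \<mu> lam z \<longleftrightarrow> lam * u' z 1 + (\<gamma> \<mu> - 1 / lam) * u z 1 = 0"
proof -
  have "l_fun \<gamma> \<mu> lam z = u' z 1 / u z 1" by (simp add: l_fun_def u'_def u_def)
  then have "kernel_equation \<gamma> \<mu> lam z \<longleftrightarrow> u z 1 \<noteq> 0 \<and> u' z 1 / u z 1 = r_fun \<gamma> \<mu> lam"
    by (simp add: kernel_equation_def u_def)
  also have "\<dots> \<longleftrightarrow> u z 1 \<noteq> 0 \<and> lam * u' z 1 + (\<gamma> \<mu> - 1 / lam) * u z 1 = 0"
    using lam by (auto simp: r_fun_def field_simps power2_eq_square)
  also have "\<dots> \<longleftrightarrow> lam * u' z 1 + (\<gamma> \<mu> - 1 / lam) * u z 1 = 0"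
    using u_u'_not_both_0[of z] lam by auto
  finally show ?thesis .
qed

text \<open>With \<open>r\<close> the right-hand side of the kernel equation, \<open>E = u u' - r u\<^sup>2\<close> vanishes at \<open>0\<close> because \<open>u\<close> does, and
at \<open>1\<close> because of the kernel equation. Completing the square in its derivative,
\<open>E' = (u' - r u)\<^sup>2 + (z - q - r\<^sup>2) u\<^sup>2\<close>, so for large \<open>z\<close> the function \<open>E\<close> is nondecreasing, hence zero, and
then \<open>u\<close> vanishes at \<open>1\<close>, which the kernel equation excludes.\<close>

lemma kernel_equation_bound:
  assumes "kernel_equation \<gamma> \<mu> lam z" and K: "\<And>s. q s \<le> K"
  shows "z \<le> K + (r_fun \<gamma> \<mu> lam)\<^sup>2"
proof (rule ccontr)
  assume "\<not> z \<le> K + (r_fun \<gamma> \<mu> lam)\<^sup>2"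
  define r where "r = r_fun \<gamma> \<mu> lam"
  have pos: "z - q s - r\<^sup>2 > 0" for s
    using K[of s] \<open>\<not> z \<le> _\<close> by (simp add: r_def)
  define E where "E s = u z s * u' z s - r * (u z s)\<^sup>2" for s
  define E' where "E' s = (u' z s - r * u z s)\<^sup>2 + (z - q s - r\<^sup>2) * (u z s)\<^sup>2" for s
  have E: "(E has_real_derivative E' s) (at s within {0..1})" if "s \<in> {0..1}" for s
    unfolding E_def[abs_def] E'_def
    by (rule derivative_eq_intros u_deriv u'_deriv that refl)+
      (simp add: power2_eq_square algebra_simps)
  have u1: "u z 1 \<noteq> 0" "u' z 1 = r * u z 1"
    using assms(1) by (auto simp: kernel_equation_def l_fun_def r_def u_def u'_def field_simps)
  have mono: "E s \<le> E t" if "0 \<le> s" "s \<le> t" "t \<le> 1" for s t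
  proof (rule DERIV_nonneg_imp_increasing_open[of s t E])
    have "continuous_on {0..1} E" using E DERIV_continuous_on by blast
    then show "continuous_on {s..t} E" by (rule continuous_on_subset) (use that in auto)
    fix x assume x: "s < x" "x < t"
    have "(E has_real_derivative E' x) (at x)"
      using E[of x] x that by (simp add: at_within_Icc_at)
    moreover have "E' x \<ge> 0" using pos[of x] by (simp add: E'_def)
    ultimately show "\<exists>y. (E has_real_derivative y) (at x) \<and> 0 \<le> y" by blast
  qed (use that in auto)
  have "E 0 = 0" "E 1 = 0" using u1 by (simp_all add: E_def u_0 power2_eq_square)
  then have "E s = 0" if "s \<in> {0..1}" for s using mono[of 0 s] mono[of s 1] that by auto
  then have "((\<lambda>_. 0) has_real_derivative E' 1) (at 1 within {0..1})"
    by (intro has_field_derivative_transform_within[OF E[of 1] zero_less_one]) auto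
  then have "E' 1 = 0"
    using has_real_derivative_unique_unit_interval[OF _ DERIV_const] by fastforce
  then show False using u1 pos[of 1] by (simp add: E'_def add_nonneg_eq_0_iff)
qed

lemma q_C1:
  obtains q' where "continuous_on {0..1} q'"
    "\<And>s. s \<in> {0..1} \<Longrightarrow> (q has_real_derivative q' s) (at s within {0..1})"
  using deriv_psi_bar_C1[OF analytic bounded_deriv, of \<mu> lam] unfolding q_def[abs_def] by blast

text \<open>The potential \<open>q\<close> is bounded because \<open>\<gamma>'\<close> is, so the preceding bound applies to every wave number in the set.\<close>

lemma finite_M_set:
  assumes "\<kappa> > 0" shows "finite (M_set \<kappa> \<gamma> \<mu> lam)"
proof -
  obtain K where "\<And>y. \<bar>deriv \<gamma> y\<bar> \<le> K" using bounded_deriv by (auto simp: bounded_iff)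
  then have K: "q s \<le> K" for s by (metis abs_le_D1 q_def)
  define R where "R = K + (r_fun \<gamma> \<mu> lam)\<^sup>2"
  have "n \<le> nat \<lceil>R / \<kappa>\<^sup>2\<rceil>" if "n \<in> M_set \<kappa> \<gamma> \<mu> lam" for n
  proof -
    have "(real n)\<^sup>2 * \<kappa>\<^sup>2 \<le> R"
      using kernel_equation_bound[OF _ K] that by (simp add: M_set_def R_def)
    then have "(real n)\<^sup>2 \<le> R / \<kappa>\<^sup>2" using assms by (simp add: field_simps)
    moreover have "real n \<le> (real n)\<^sup>2" by (cases n) (auto simp: power2_eq_square)
    ultimately show ?thesis by linarith
  qed
  then show ?thesis by (meson finite_nat_set_iff_bounded_le)
qed

lemma Phi_eq: "Phi \<kappa> \<gamma> \<mu> lam n = (\<lambda>(x, s). cos (real n * \<kappa> * x) * u ((real n * \<kappa>)\<^sup>2) s)"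
  by (simp add: Phi_def u_def power_mult_distrib)

lemma laplacian_mode:
  assumes "s \<in> {0..1}"
  shows "laplacian (\<lambda>(x, s). cos (a * x) * u (a\<^sup>2) s) (x, s) = - q s * (cos (a * x) * u (a\<^sup>2) s)"
proof -
  let ?D = "closure Omega" and ?f = "\<lambda>(x, s). cos (a * x) * u (a\<^sup>2) s"
  have C: "((\<lambda>x. cos (a * x)) has_real_derivative - a * sin (a * x)) (at x)"
    "((\<lambda>x. - a * sin (a * x)) has_real_derivative - a\<^sup>2 * cos (a * x)) (at x)" for x
    by (auto intro!: derivative_eq_intros simp: power2_eq_square)
  have "pdiff ?D (1, 0) (pdiff ?D (1, 0) ?f) (x, s)
      = pdiff ?D (1, 0) (\<lambda>(x, s). (- a * sin (a * x)) * u (a\<^sup>2) s) (x, s)"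
    using assms pdiff_x_separated[OF C(1) u_deriv]
    by (intro pdiff_cong) (auto simp: closure_Omega)
  also have "\<dots> = - a\<^sup>2 * cos (a * x) * u (a\<^sup>2) s"
    by (rule pdiff_x_separated[OF C(2) u_deriv[OF assms] assms])
  finally have xx: "pdiff ?D (1, 0) (pdiff ?D (1, 0) ?f) (x, s) = - a\<^sup>2 * cos (a * x) * u (a\<^sup>2) s" .
  have "pdiff ?D (0, 1) (pdiff ?D (0, 1) ?f) (x, s)
      = pdiff ?D (0, 1) (\<lambda>(x, s). cos (a * x) * u' (a\<^sup>2) s) (x, s)"
    using assms pdiff_s_separated[OF C(1) u_deriv]
    by (intro pdiff_cong) (auto simp: closure_Omega)
  also have "\<dots> = cos (a * x) * (- (q s - a\<^sup>2) * u (a\<^sup>2) s)"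
    by (rule pdiff_s_separated[OF C(1) u'_deriv[OF assms] assms])
  finally have ss: "pdiff ?D (0, 1) (pdiff ?D (0, 1) ?f) (x, s) = cos (a * x) * (- (q s - a\<^sup>2) * u (a\<^sup>2) s)" .
  show ?thesis unfolding laplacian_def xx ss by (simp add: algebra_simps)
qed

lemma holder_class_mode:
  assumes "0 < \<beta>" "\<beta> \<le> 1"
  shows "holder_class (closure Omega) \<beta> 2 (\<lambda>(x, s). cos (a * x) * u z s)"
proof -
  have C: "((\<lambda>x. cos (a * x)) has_real_derivative - a * sin (a * x)) (at x)"
    "((\<lambda>x. - a * sin (a * x)) has_real_derivative - a\<^sup>2 * cos (a * x)) (at x)" for x
    by (auto intro!: derivative_eq_intros simp: power2_eq_square)
  obtain q' where q': "continuous_on {0..1} q'"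
    "\<And>s. s \<in> {0..1} \<Longrightarrow> (q has_real_derivative q' s) (at s within {0..1})"
    using q_C1 by blast
  have q_cont: "continuous_on {0..1} q" using q'(2) by (rule DERIV_continuous_on)
  have u_cont: "continuous_on {0..1} (u z)" using u_deriv by (rule DERIV_continuous_on)
  have u'_cont: "continuous_on {0..1} (u' z)" using u'_deriv by (rule DERIV_continuous_on)
  have u''_cont: "continuous_on {0..1} (\<lambda>s. - (q s - z) * u z s)"
    by (intro continuous_intros q_cont u_cont)
  have u''_deriv: "((\<lambda>s. - (q s - z) * u z s) has_real_derivative
      - q' s * u z s - (q s - z) * u' z s) (at s within {0..1})" if "s \<in> {0..1}" for s
    by (rule derivative_eq_intros q'(2) u_deriv that refl)+ (simp add: algebra_simps)
  obtain K0 where K0: "K0-lipschitz_on {0..1} (u z)"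
    using lipschitz_on_unit_interval_C1[OF u_deriv u'_cont] .
  obtain K1 where K1: "K1-lipschitz_on {0..1} (u' z)"
    using lipschitz_on_unit_interval_C1[OF u'_deriv u''_cont] .
  obtain K2 where K2: "K2-lipschitz_on {0..1} (\<lambda>s. - (q s - z) * u z s)"
    by (rule lipschitz_on_unit_interval_C1[OF u''_deriv])
      (auto intro!: continuous_intros q_cont q' u_cont u'_cont)
  show ?thesis
    by (rule holder_class_2_separated[OF C u_deriv u'_deriv _
          bounded_range_scaled_trig(2) bounded_range_scaled_trig(1) _ _ _ _
          lipschitz_on_scaled_trig(2) lipschitz_on_scaled_trig(1) K0 K1 K2 assms])
      (use bounded_range_scaled_trig(1)[of 1 a] lipschitz_on_scaled_trig(1)[of a 1]
        in \<open>auto intro!: compact_imp_bounded compact_continuous_image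
          continuous_intros q_cont u_cont u'_cont\<close>)
qed

lemma mode_in_ker_L:
  assumes "\<kappa> > 0" "0 < \<beta>" "\<beta> \<le> 1" "n \<in> M_set \<kappa> \<gamma> \<mu> lam"
  shows "Phi \<kappa> \<gamma> \<mu> lam n \<in> ker_L \<kappa> \<beta> \<gamma> \<mu> lam"
proof -
  let ?a = "real n * \<kappa>"
  let ?\<Phi> = "\<lambda>(x, s). cos (?a * x) * u (?a\<^sup>2) s"
  have kern: "lam * u' (?a\<^sup>2) 1 + (\<gamma> \<mu> - 1 / lam) * u (?a\<^sup>2) 1 = 0"
    using assms(4) by (simp add: M_set_def kernel_equation_iff power_mult_distrib)
  have "?\<Phi> \<in> X2 \<kappa> \<beta>"
  proof -
    have "cos (?a * (x + 2 * pi / \<kappa>)) = cos (?a * x)" for x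
    proof -
      have "?a * (x + 2 * pi / \<kappa>) = ?a * x + 2 * pi * of_int (int n)"
        using assms(1) by (simp add: field_simps)
      then show ?thesis by (simp only: cos_add cos_int_2pin sin_int_2pin)
    qed
    then show ?thesis
      using holder_class_mode[OF assms(2,3), of ?a] u_outside u_0
      by (auto simp: X2_def closure_Omega)
  qed
  moreover have "L1 \<gamma> \<mu> lam ?\<Phi> = 0"
  proof
    fix x
    have "((\<lambda>x. cos (?a * x)) has_real_derivative - ?a * sin (?a * x)) (at x)"
      by (auto intro!: derivative_eq_intros)
    then have "L1 \<gamma> \<mu> lam ?\<Phi> x = cos (?a * x) * (lam * u' (?a\<^sup>2) 1 + (\<gamma> \<mu> - 1 / lam) * u (?a\<^sup>2) 1)"
      by (simp add: L1_def pdiff_s_separated[OF _ u_deriv] algebra_simps)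
    then show "L1 \<gamma> \<mu> lam ?\<Phi> x = 0 x" by (simp add: kern)
  qed
  moreover have "L2 \<gamma> \<mu> lam ?\<Phi> = 0"
    using laplacian_mode[of _ ?a] by (auto simp: L2_def fun_eq_iff closure_Omega q_def)
  ultimately show ?thesis by (simp add: ker_L_def Phi_eq)
qed

end

section \<open>The kernel\<close>

lemma has_real_derivative_cos_coefficient:
  assumes f: "f differentiable_on closure Omega"
    and cont: "continuous_on (closure Omega) (pdiff (closure Omega) (0, 1) f)"
    and s: "s \<in> {0..1}"
  shows "((\<lambda>s. integral {0..T} (\<lambda>x. f (x, s) * cos (a * x))) has_real_derivative
    integral {0..T} (\<lambda>x. pdiff (closure Omega) (0, 1) f (x, s) * cos (a * x))) (at s within {0..1})"
  unfolding cbox_interval[symmetric]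
proof (rule leibniz_rule_field_derivative)
  fix r x :: real assume "r \<in> cbox 0 1"
  then have r: "r \<in> {0..1}" by simp
  show "((\<lambda>s. f (x, s) * cos (a * x)) has_real_derivative
      pdiff (closure Omega) (0, 1) f (x, r) * cos (a * x)) (at r within cbox 0 1)"
    using DERIV_cmult_right[OF has_real_derivative_pdiff_s[OF f r]] by simp
  have "continuous_on UNIV (\<lambda>x. f (x, r))"
    using has_real_derivative_pdiff_x[OF f r] DERIV_isCont
    by (intro continuous_at_imp_continuous_on) blast
  then show "(\<lambda>x. f (x, r) * cos (a * x)) integrable_on cbox 0 T"
    by (intro integrable_continuous continuous_intros) (auto intro: continuous_on_subset)
next
  have "continuous_on (cbox 0 1 \<times> cbox 0 T) (\<lambda>z. pdiff (closure Omega) (0, 1) f (snd z, fst z))"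
    by (intro continuous_on_compose2[OF cont] continuous_intros) (auto simp: closure_Omega)
  then show "continuous_on (cbox 0 1 \<times> cbox 0 T)
      (\<lambda>(s, x). pdiff (closure Omega) (0, 1) f (x, s) * cos (a * x))"
    by (auto simp: case_prod_beta intro!: continuous_intros)
qed (use s in auto)

text \<open>Two integrations by parts at once: \<open>f' cos (a x) + a f sin (a x)\<close> has derivative
\<open>f'' cos (a x) + a\<^sup>2 f cos (a x)\<close> and vanishes at both ends.\<close>

lemma cos_coefficient_second_deriv:
  fixes f :: "real \<Rightarrow> real"
  assumes "\<And>x. (f has_real_derivative f' x) (at x)" "\<And>x. (f' has_real_derivative f'' x) (at x)"
    and "T \<ge> 0" and ends: "f' 0 = 0" "f' T = 0" "sin (a * T) = 0"
    and cont: "continuous_on {0..T} f''"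
  shows "integral {0..T} (\<lambda>x. f'' x * cos (a * x)) = - a\<^sup>2 * integral {0..T} (\<lambda>x. f x * cos (a * x))"
proof -
  have f_cont: "continuous_on {0..T} f"
    using assms(1) DERIV_isCont by (intro continuous_at_imp_continuous_on) blast
  define F where "F x = f' x * cos (a * x) + a * f x * sin (a * x)" for x
  have "((\<lambda>x. f'' x * cos (a * x) + a\<^sup>2 * (f x * cos (a * x))) has_integral (F T - F 0)) {0..T}"
  proof (rule fundamental_theorem_of_calculus[OF assms(3)])
    fix x
    have "(F has_real_derivative f'' x * cos (a * x) + a\<^sup>2 * (f x * cos (a * x))) (at x)"
      unfolding F_def[abs_def]
      by (rule derivative_eq_intros assms(1,2) refl)+ (simp add: power2_eq_square algebra_simps)
    then show "(F has_vector_derivative f'' x * cos (a * x) + a\<^sup>2 * (f x * cos (a * x))) (at x within {0..T})"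
      by (simp add: has_real_derivative_iff_has_vector_derivative has_vector_derivative_at_within)
  qed
  then have "integral {0..T} (\<lambda>x. f'' x * cos (a * x) + a\<^sup>2 * (f x * cos (a * x))) = 0"
    using ends by (simp add: integral_unique F_def)
  moreover have "integral {0..T} (\<lambda>x. f'' x * cos (a * x) + a\<^sup>2 * (f x * cos (a * x)))
      = integral {0..T} (\<lambda>x. f'' x * cos (a * x)) + integral {0..T} (\<lambda>x. a\<^sup>2 * (f x * cos (a * x)))"
    by (intro integral_add integrable_continuous_real continuous_intros cont f_cont)
  ultimately show ?thesis by simp
qed

lemma X2_regularity:
  assumes "\<Phi> \<in> X2 \<kappa> \<beta>" "\<beta> > 0" "b \<in> Basis" "b' \<in> Basis"
  shows "\<Phi> differentiable_on closure Omega"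
    and "pdiff (closure Omega) b \<Phi> differentiable_on closure Omega"
    and "continuous_on (closure Omega) (pdiff (closure Omega) b' (pdiff (closure Omega) b \<Phi>))"
proof -
  have *: "holder_class (closure Omega) \<beta> (Suc (Suc 0)) \<Phi>"
    using assms(1) by (simp add: X2_def numeral_2_eq_2)
  then show "\<Phi> differentiable_on closure Omega" by simp
  have **: "holder_class (closure Omega) \<beta> (Suc 0) (pdiff (closure Omega) b \<Phi>)"
    using * assms(3) unfolding holder_class.simps(2)[of _ _ "Suc 0"] by blast
  then show "pdiff (closure Omega) b \<Phi> differentiable_on closure Omega" by simp
  have "holder_class (closure Omega) \<beta> 0 (pdiff (closure Omega) b' (pdiff (closure Omega) b \<Phi>))"
    using ** assms(4) unfolding holder_class.simps(2) by blast
  then show "continuous_on (closure Omega) (pdiff (closure Omega) b' (pdiff (closure Omega) b \<Phi>))"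
    using holder_class_0_imp_continuous_on assms(2) by blast
qed

lemma Basis_plane: "(1, 0) \<in> (Basis :: (real \<times> real) set)" "(0, 1) \<in> (Basis :: (real \<times> real) set)"
  by (auto simp: Basis_prod_def)

lemma continuous_on_X2_horizontal:
  assumes "\<Phi> \<in> X2 \<kappa> \<beta>" "\<beta> > 0" "s \<in> {0..1}"
  shows "continuous_on A (\<lambda>x. \<Phi> (x, s))"
  using has_real_derivative_pdiff_x[OF X2_regularity(1)[OF assms(1,2) Basis_plane] assms(3)] DERIV_isCont
  by (intro continuous_at_imp_continuous_on) blast

text \<open>The operators are built from choice-based derivatives, so their linearity holds only on functions that are
regular enough.\<close>

lemma X2_L1_L2_lincomb:
  assumes \<Phi>: "\<Phi> \<in> X2 \<kappa> \<beta>" and \<Psi>: "\<Psi> \<in> X2 \<kappa> \<beta>" and \<beta>: "\<beta> > 0"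
  shows "(\<lambda>z. a * \<Phi> z + \<Psi> z) \<in> X2 \<kappa> \<beta>"
    and "L1 \<gamma> \<mu> lam (\<lambda>z. a * \<Phi> z + \<Psi> z) x = a * L1 \<gamma> \<mu> lam \<Phi> x + L1 \<gamma> \<mu> lam \<Psi> x"
    and "L2 \<gamma> \<mu> lam (\<lambda>z. a * \<Phi> z + \<Psi> z) w = a * L2 \<gamma> \<mu> lam \<Phi> w + L2 \<gamma> \<mu> lam \<Psi> w"
proof -
  let ?D = "closure Omega"
  show "(\<lambda>z. a * \<Phi> z + \<Psi> z) \<in> X2 \<kappa> \<beta>"
    using \<Phi> \<Psi> holder_class_lincomb_strip[of \<beta> 2 \<Phi> \<Psi> a] by (auto simp: X2_def)
  have pdiff1: "pdiff ?D b (\<lambda>z. a * \<Phi> z + \<Psi> z) w = a * pdiff ?D b \<Phi> w + pdiff ?D b \<Psi> w"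
    if "b \<in> Basis" "w \<in> ?D" for b w
    using X2_regularity(1)[OF \<Phi> \<beta> that(1,1)] X2_regularity(1)[OF \<Psi> \<beta> that(1,1)] that
    by (intro pdiff_lincomb_strip) (auto simp: differentiable_on_def)
  have pdiff2: "pdiff ?D b (pdiff ?D b (\<lambda>z. a * \<Phi> z + \<Psi> z)) w
      = a * pdiff ?D b (pdiff ?D b \<Phi>) w + pdiff ?D b (pdiff ?D b \<Psi>) w"
    if "b \<in> Basis" "w \<in> ?D" for b w
  proof -
    have "pdiff ?D b (pdiff ?D b (\<lambda>z. a * \<Phi> z + \<Psi> z)) w
        = pdiff ?D b (\<lambda>w. a * pdiff ?D b \<Phi> w + pdiff ?D b \<Psi> w) w"
      using that by (intro pdiff_cong pdiff1)
    also have "\<dots> = a * pdiff ?D b (pdiff ?D b \<Phi>) w + pdiff ?D b (pdiff ?D b \<Psi>) w"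
      using X2_regularity(2)[OF \<Phi> \<beta> that(1,1)] X2_regularity(2)[OF \<Psi> \<beta> that(1,1)] that
      by (intro pdiff_lincomb_strip) (auto simp: differentiable_on_def)
    finally show ?thesis .
  qed
  show "L1 \<gamma> \<mu> lam (\<lambda>z. a * \<Phi> z + \<Psi> z) x = a * L1 \<gamma> \<mu> lam \<Phi> x + L1 \<gamma> \<mu> lam \<Psi> x"
  proof -
    have "(x, 1) \<in> ?D" by (simp add: closure_Omega)
    note eq = pdiff1[OF Basis_plane(2) this]
    show ?thesis unfolding L1_def eq by (simp add: algebra_simps)
  qed
  show "L2 \<gamma> \<mu> lam (\<lambda>z. a * \<Phi> z + \<Psi> z) w = a * L2 \<gamma> \<mu> lam \<Phi> w + L2 \<gamma> \<mu> lam \<Psi> w"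
  proof (cases "w \<in> ?D")
    case True
    note eqs = pdiff2[OF Basis_plane(1) True] pdiff2[OF Basis_plane(2) True]
    show ?thesis using True unfolding L2_def laplacian_def eqs by (simp add: algebra_simps)
  qed (simp add: L2_def)
qed

lemma subspace_ker_L:
  assumes "\<beta> > 0"
  shows "subspace (ker_L \<kappa> \<beta> \<gamma> \<mu> lam)"
proof (rule subspaceI)
  have zero: "(\<lambda>_. 0) \<in> X2 \<kappa> \<beta>" by (simp add: X2_def holder_class_zero_strip)
  \<comment> \<open>By additivity the image of zero is twice itself.\<close>
  have "L1 \<gamma> \<mu> lam (\<lambda>_. 0) x = 0" "L2 \<gamma> \<mu> lam (\<lambda>_. 0) z = 0" for x z
    using X2_L1_L2_lincomb(2,3)[OF zero zero assms, of \<gamma> \<mu> lam 1] by simp_all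
  then have zero_ker: "(\<lambda>_. 0) \<in> ker_L \<kappa> \<beta> \<gamma> \<mu> lam"
    using zero by (simp add: ker_L_def fun_eq_iff)
  then show "0 \<in> ker_L \<kappa> \<beta> \<gamma> \<mu> lam" by (simp add: zero_fun_def)
  have lincomb: "(\<lambda>z. a * \<Phi> z + \<Psi> z) \<in> ker_L \<kappa> \<beta> \<gamma> \<mu> lam"
    if "\<Phi> \<in> ker_L \<kappa> \<beta> \<gamma> \<mu> lam" "\<Psi> \<in> ker_L \<kappa> \<beta> \<gamma> \<mu> lam" for a \<Phi> \<Psi>
    using that X2_L1_L2_lincomb[of \<Phi> \<kappa> \<beta> \<Psi>, OF _ _ assms] by (simp add: ker_L_def fun_eq_iff)
  show "\<Phi> + \<Psi> \<in> ker_L \<kappa> \<beta> \<gamma> \<mu> lam"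
    if "\<Phi> \<in> ker_L \<kappa> \<beta> \<gamma> \<mu> lam" "\<Psi> \<in> ker_L \<kappa> \<beta> \<gamma> \<mu> lam" for \<Phi> \<Psi>
    using lincomb[OF that, of 1] by (simp add: plus_fun_def)
  show "a *\<^sub>R \<Phi> \<in> ker_L \<kappa> \<beta> \<gamma> \<mu> lam" if "\<Phi> \<in> ker_L \<kappa> \<beta> \<gamma> \<mu> lam" for a \<Phi>
    using lincomb[OF that zero_ker, of a] by (simp add: scaleR_fun_def)
qed

lemma sum_fun_apply: "(\<Sum>i\<in>I. f i) x = (\<Sum>i\<in>I. f i x)"
  for f :: "'i \<Rightarrow> 'b \<Rightarrow> 'c::comm_monoid_add"
  by (induction I rule: infinite_finite_induct) auto

text \<open>Linear independence of the family is stated with coefficients indexed by \<open>I\<close>, so it also yields injectivity: a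
repeated vector would give the relation with coefficients \<open>1\<close> and \<open>-1\<close>.\<close>

lemma basis_family_finiteI:
  fixes b :: "'i \<Rightarrow> 'v::real_vector"
  assumes fin: "finite I" and lin: "\<And>c. (\<Sum>i\<in>I. c i *\<^sub>R b i) = 0 \<Longrightarrow> (\<forall>i\<in>I. c i = 0)"
    and V: "subspace V" "\<And>i. i \<in> I \<Longrightarrow> b i \<in> V"
      "\<And>v. v \<in> V \<Longrightarrow> \<exists>c. v = (\<Sum>i\<in>I. c i *\<^sub>R b i)"
  shows "basis_family b I V"
  unfolding basis_family_def
proof (intro conjI)
  show inj: "inj_on b I"
  proof (rule inj_onI, rule ccontr)
    fix i j assume ij: "i \<in> I" "j \<in> I" "b i = b j" "i \<noteq> j"
    define c where "c k = (if k = i then 1 else 0) - (if k = j then 1 else (0::real))" for k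
    have "(\<Sum>k\<in>I. c k *\<^sub>R b k)
        = (\<Sum>k\<in>I. (if k = i then b k else 0)) - (\<Sum>k\<in>I. (if k = j then b k else 0))"
      by (subst sum_subtractf[symmetric]) (auto simp: c_def intro!: sum.cong)
    also have "\<dots> = 0" using ij fin by simp
    finally have "c i = 0" using lin ij by blast
    then show False using ij by (simp add: c_def)
  qed
  show "independent (b ` I)"
  proof (rule independent_if_scalars_zero)
    show "finite (b ` I)" using fin by simp
    fix f x assume "(\<Sum>x\<in>b ` I. f x *\<^sub>R x) = 0" "x \<in> b ` I"
    moreover from this(1) have "\<forall>i\<in>I. f (b i) = 0"
      by (intro lin) (simp add: sum.reindex[OF inj])
    ultimately show "f x = 0" by auto
  qed
  show "span (b ` I) = V"
  proof
    show "span (b ` I) \<subseteq> V" using V by (intro span_minimal) auto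
    show "V \<subseteq> span (b ` I)"
    proof
      fix v assume "v \<in> V"
      then obtain c where "v = (\<Sum>i\<in>I. c i *\<^sub>R b i)" using V(3) by blast
      then show "v \<in> span (b ` I)" by (simp only:) (intro span_sum span_scale span_base imageI)
    qed
  qed
qed

context linearised_problem
begin

text \<open>Integrating the equation of the interior against \<open>cos (n \<kappa> x)\<close> over a half period turns it into the ordinary
differential equation of \<open>u(s; n\<^sup>2\<kappa>\<^sup>2)\<close>, and vanishing on the bed leaves a multiple \<open>c u\<close>. Integrating the
boundary condition in the same way gives \<open>c (lam u'(1) + (\<gamma>(\<mu>) - 1/lam) u(1)) = 0\<close>, so \<open>c = 0\<close> unless \<open>n\<close>
satisfies the kernel equation.\<close>

lemma cos_coefficient_of_kernel_element:
  assumes \<kappa>: "\<kappa> > 0" and \<beta>: "\<beta> > 0" and \<Phi>: "\<Phi> \<in> ker_L \<kappa> \<beta> \<gamma> \<mu> lam"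
  obtains c where
    "\<And>s. s \<in> {0..1} \<Longrightarrow>
      integral {0..pi / \<kappa>} (\<lambda>x. \<Phi> (x, s) * cos (real n * \<kappa> * x)) = c * u ((real n * \<kappa>)\<^sup>2) s"
    "n \<notin> M_set \<kappa> \<gamma> \<mu> lam \<Longrightarrow> c = 0"
proof -
  let ?D = "closure Omega" and ?T = "pi / \<kappa>"
  define a where "a = real n * \<kappa>"
  have X2: "\<Phi> \<in> X2 \<kappa> \<beta>" and L1: "L1 \<gamma> \<mu> lam \<Phi> x = 0" and L2: "L2 \<gamma> \<mu> lam \<Phi> z = 0" for x z
    using \<Phi> by (simp_all add: ker_L_def)
  have sym: "\<Phi> (x + 2 * pi / \<kappa>, s) = \<Phi> (x, s)" "\<Phi> (- x, s) = \<Phi> (x, s)" and bot: "\<Phi> (x, 0) = 0" for x s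
    using X2 by (auto simp: X2_def)
  define \<Phi>x where "\<Phi>x = pdiff ?D (1, 0) \<Phi>"
  define \<Phi>s where "\<Phi>s = pdiff ?D (0, 1) \<Phi>"
  define \<Phi>xx where "\<Phi>xx = pdiff ?D (1, 0) \<Phi>x"
  define \<Phi>ss where "\<Phi>ss = pdiff ?D (0, 1) \<Phi>s"
  note reg = X2_regularity[OF X2 \<beta>]
  have diff: "\<Phi> differentiable_on ?D" "\<Phi>x differentiable_on ?D" "\<Phi>s differentiable_on ?D"
    using reg(1)[OF Basis_plane(1,1)] reg(2)[OF Basis_plane(1,1)] reg(2)[OF Basis_plane(2,1)]
    by (auto simp: \<Phi>x_def \<Phi>s_def)
  have cont: "continuous_on ?D \<Phi>xx" "continuous_on ?D \<Phi>ss" "continuous_on ?D \<Phi>s" "continuous_on ?D \<Phi>"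
    using reg(3)[OF Basis_plane(1,1)] reg(3)[OF Basis_plane(2,2)] diff
    by (auto simp: \<Phi>xx_def \<Phi>ss_def \<Phi>x_def \<Phi>s_def differentiable_imp_continuous_on)
  have line: "continuous_on S (\<lambda>x. g (x, s))" if "continuous_on ?D g" "s \<in> {0..1}"
    for S s and g :: "real \<times> real \<Rightarrow> real"
    using that by (intro continuous_on_compose2[OF that(1)] continuous_intros) (auto simp: closure_Omega)
  define \<phi> where "\<phi> s = integral {0..?T} (\<lambda>x. \<Phi> (x, s) * cos (a * x))" for s
  define \<phi>' where "\<phi>' s = integral {0..?T} (\<lambda>x. \<Phi>s (x, s) * cos (a * x))" for s
  have \<phi>_deriv: "(\<phi> has_real_derivative \<phi>' s) (at s within {0..1})" if "s \<in> {0..1}" for s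
    using has_real_derivative_cos_coefficient[OF diff(1) _ that, of ?T a] cont(3)
    by (simp add: \<phi>_def[abs_def] \<phi>'_def \<Phi>s_def)
  have \<phi>'_deriv: "(\<phi>' has_real_derivative - (q s - a\<^sup>2) * \<phi> s) (at s within {0..1})"
    if s: "s \<in> {0..1}" for s
  proof -
    have by_parts: "integral {0..?T} (\<lambda>x. \<Phi>xx (x, s) * cos (a * x)) = - a\<^sup>2 * \<phi> s"
      unfolding \<phi>_def
    proof (rule cos_coefficient_second_deriv)
      show dx: "((\<lambda>x. \<Phi> (x, s)) has_real_derivative \<Phi>x (x, s)) (at x)" for x
        unfolding \<Phi>x_def by (rule has_real_derivative_pdiff_x[OF diff(1) s])
      show "((\<lambda>x. \<Phi>x (x, s)) has_real_derivative \<Phi>xx (x, s)) (at x)" for x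
        unfolding \<Phi>xx_def by (rule has_real_derivative_pdiff_x[OF diff(2) s])
      show "\<Phi>x (0, s) = 0"
        by (rule reflection_symmetric_deriv_eq_0[OF _ dx[of 0]]) (use sym in simp)
      show "\<Phi>x (?T, s) = 0"
      proof (rule reflection_symmetric_deriv_eq_0[OF _ dx[of ?T]])
        fix x
        show "\<Phi> (2 * ?T - x, s) = \<Phi> (x, s)" using sym(1)[of "- x" s] sym(2)[of x s] by simp
      qed
      show "sin (a * ?T) = 0" using \<kappa> by (simp add: a_def)
      show "continuous_on {0..?T} (\<lambda>x. \<Phi>xx (x, s))" by (rule line[OF cont(1) s])
    qed (use \<kappa> in simp)
    have "\<Phi>ss (x, s) = - q s * \<Phi> (x, s) - \<Phi>xx (x, s)" for x
      using L2[of "(x, s)"] s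
      by (simp add: L2_def laplacian_def closure_Omega q_def \<Phi>xx_def \<Phi>ss_def \<Phi>x_def \<Phi>s_def)
    then have "integral {0..?T} (\<lambda>x. \<Phi>ss (x, s) * cos (a * x))
        = integral {0..?T} (\<lambda>x. - q s * (\<Phi> (x, s) * cos (a * x)) - \<Phi>xx (x, s) * cos (a * x))"
      by (simp only: left_diff_distrib mult.assoc)
    also have "\<dots> = integral {0..?T} (\<lambda>x. - q s * (\<Phi> (x, s) * cos (a * x)))
        - integral {0..?T} (\<lambda>x. \<Phi>xx (x, s) * cos (a * x))"
      by (intro Henstock_Kurzweil_Integration.integral_diff integrable_continuous_real continuous_intros
          line[OF cont(1) s] line[OF cont(4) s])
    also have "\<dots> = - (q s - a\<^sup>2) * \<phi> s"
      by (simp add: by_parts) (simp add: \<phi>_def algebra_simps)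
    finally have "integral {0..?T} (\<lambda>x. \<Phi>ss (x, s) * cos (a * x)) = - (q s - a\<^sup>2) * \<phi> s" .
    then show ?thesis
      using has_real_derivative_cos_coefficient[OF diff(3) _ s, of ?T a] cont(2)
      by (simp add: \<phi>'_def[abs_def] \<Phi>ss_def)
  qed
  define c where "c = \<phi>' 0"
  have cu: "((\<lambda>s. c * u (a\<^sup>2) s) has_real_derivative c * u' (a\<^sup>2) s) (at s within {0..1})"
    "((\<lambda>s. c * u' (a\<^sup>2) s) has_real_derivative - (q s - a\<^sup>2) * (c * u (a\<^sup>2) s)) (at s within {0..1})"
    if "s \<in> {0..1}" for s
    using DERIV_cmult[OF u_deriv[OF that], of c] DERIV_cmult[OF u'_deriv[OF that], of c]
    by (simp_all add: mult_ac)
  have init: "\<phi> 0 = c * u (a\<^sup>2) 0" "\<phi>' 0 = c * u' (a\<^sup>2) 0"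
    by (simp_all add: \<phi>_def bot u_0 u'_0 c_def)
  note unique = linear_ivp_unique[OF disjI1[OF refl] \<phi>_deriv \<phi>'_deriv cu init]
  show ?thesis
  proof (rule that)
    show "integral {0..?T} (\<lambda>x. \<Phi> (x, s) * cos (real n * \<kappa> * x)) = c * u ((real n * \<kappa>)\<^sup>2) s"
      if "s \<in> {0..1}" for s
      using unique(1)[OF _ _ _ _ that] by (simp add: \<phi>_def a_def)
    assume n: "n \<notin> M_set \<kappa> \<gamma> \<mu> lam"
    have "lam * \<phi>' 1 + (\<gamma> \<mu> - 1 / lam) * \<phi> 1
        = integral {0..?T} (\<lambda>x. lam * (\<Phi>s (x, 1) * cos (a * x)))
          + integral {0..?T} (\<lambda>x. (\<gamma> \<mu> - 1 / lam) * (\<Phi> (x, 1) * cos (a * x)))"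
      by (simp add: \<phi>_def \<phi>'_def)
    also have "\<dots> = integral {0..?T} (\<lambda>x. lam * (\<Phi>s (x, 1) * cos (a * x))
        + (\<gamma> \<mu> - 1 / lam) * (\<Phi> (x, 1) * cos (a * x)))"
      by (intro integral_add[symmetric] integrable_continuous_real continuous_intros
          line cont) auto
    also have "\<dots> = integral {0..?T} (\<lambda>x. L1 \<gamma> \<mu> lam \<Phi> x * cos (a * x))"
      by (simp only: L1_def \<Phi>s_def distrib_right mult.assoc)
    also have "\<dots> = 0" by (simp add: L1)
    finally have "c * (lam * u' (a\<^sup>2) 1 + (\<gamma> \<mu> - 1 / lam) * u (a\<^sup>2) 1) = 0"
      using unique[of 1] by (simp add: algebra_simps)
    moreover have "lam * u' (a\<^sup>2) 1 + (\<gamma> \<mu> - 1 / lam) * u (a\<^sup>2) 1 \<noteq> 0"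
      using n by (simp add: M_set_def kernel_equation_iff a_def power_mult_distrib)
    ultimately show "c = 0" by (metis mult_eq_0_iff)
  qed
qed

lemma cos_coefficient_mode_sum:
  assumes \<kappa>: "\<kappa> > 0" and "finite M"
  shows "integral {0..pi / \<kappa>} (\<lambda>x. (\<Sum>n\<in>M. c n * Phi \<kappa> \<gamma> \<mu> lam n (x, s)) * cos (real m * \<kappa> * x))
    = (if m \<in> M then c m * u ((real m * \<kappa>)\<^sup>2) s
        * integral {0..pi / \<kappa>} (\<lambda>x. cos (real m * \<kappa> * x) * cos (real m * \<kappa> * x)) else 0)"
proof -
  let ?I = "\<lambda>n. integral {0..pi / \<kappa>} (\<lambda>x. cos (real n * \<kappa> * x) * cos (real m * \<kappa> * x))"
  have "integral {0..pi / \<kappa>} (\<lambda>x. (\<Sum>n\<in>M. c n * Phi \<kappa> \<gamma> \<mu> lam n (x, s)) * cos (real m * \<kappa> * x))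
    = integral {0..pi / \<kappa>} (\<lambda>x. \<Sum>n\<in>M. (c n * u ((real n * \<kappa>)\<^sup>2) s)
        * (cos (real n * \<kappa> * x) * cos (real m * \<kappa> * x)))"
    by (simp add: Phi_eq sum_distrib_right sum_distrib_left mult_ac)
  also have "\<dots> = (\<Sum>n\<in>M. integral {0..pi / \<kappa>} (\<lambda>x. (c n * u ((real n * \<kappa>)\<^sup>2) s)
        * (cos (real n * \<kappa> * x) * cos (real m * \<kappa> * x))))"
    by (intro integral_sum assms(2) integrable_continuous_real continuous_intros)
  also have "\<dots> = (\<Sum>n\<in>M. (c n * u ((real n * \<kappa>)\<^sup>2) s) * ?I n)"
    by (simp only: integral_mult_right)
  also have "\<dots> = (\<Sum>n\<in>M. if n = m then c m * u ((real m * \<kappa>)\<^sup>2) s * ?I m else 0)"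
    using cosine_system_orthogonal[OF \<kappa>] by (intro sum.cong) auto
  also have "\<dots> = (if m \<in> M then c m * u ((real m * \<kappa>)\<^sup>2) s * ?I m else 0)"
    using assms(2) by simp
  finally show ?thesis .
qed

text \<open>By evenness and periodicity a half period determines the function, and there completeness applies at
each height \<open>s\<close> separately.\<close>

lemma kernel_element_zero:
  assumes "\<kappa> > 0" "\<beta> > 0" "\<Phi> \<in> ker_L \<kappa> \<beta> \<gamma> \<mu> lam"
    and zero: "\<And>n s. s \<in> {0..1} \<Longrightarrow>
      integral {0..pi / \<kappa>} (\<lambda>x. \<Phi> (x, s) * cos (real n * \<kappa> * x)) = 0"
  shows "\<Phi> = 0"
proof
  fix z :: "real \<times> real"
  obtain x s where z: "z = (x, s)" by (cases z)
  have X2: "\<Phi> \<in> X2 \<kappa> \<beta>" using assms(3) by (simp add: ker_L_def)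
  show "\<Phi> z = 0 z"
  proof (cases "s \<in> {0..1}")
    case s: True
    note cont = continuous_on_X2_horizontal[OF X2 assms(2) s]
    have "\<Phi> (x, s) = 0"
    proof (rule periodic_even_zero[of "pi / \<kappa>" "\<lambda>x. \<Phi> (x, s)"])
      show "\<Phi> (x, s) = 0" if "x \<in> {0..pi / \<kappa>}" for x
        by (rule cosine_system_complete[OF assms(1) cont zero[OF s] that])
    qed (use X2 assms(1) in \<open>auto simp: X2_def\<close>)
    then show ?thesis by (simp add: z)
  next
    case False
    then show ?thesis using X2 by (auto simp: z X2_def closure_Omega)
  qed
qed

end

theorem theorem9:
  fixes \<kappa> \<beta> \<mu> lam :: real and \<gamma> :: "real \<Rightarrow> real"
  assumes "\<kappa> > 0" and "0 < \<beta>" and "\<beta> < 1"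
    and "real_analytic \<gamma>" and "bounded (range (deriv \<gamma>))"
    and "lam \<noteq> 0"
  shows "finite (M_set \<kappa> \<gamma> \<mu> lam)
    \<and> basis_family (Phi \<kappa> \<gamma> \<mu> lam) (M_set \<kappa> \<gamma> \<mu> lam) (ker_L \<kappa> \<beta> \<gamma> \<mu> lam)"
proof
  interpret linearised_problem \<gamma> \<mu> lam
    using assms(4-6) by unfold_locales
  let ?M = "M_set \<kappa> \<gamma> \<mu> lam" and ?\<Phi> = "Phi \<kappa> \<gamma> \<mu> lam" and ?V = "ker_L \<kappa> \<beta> \<gamma> \<mu> lam"
  define N where "N n = integral {0..pi / \<kappa>} (\<lambda>x. cos (real n * \<kappa> * x) * cos (real n * \<kappa> * x))" for n
  have N: "N n \<noteq> 0" for n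
    unfolding N_def by (rule cosine_system_norm_neq_0[OF assms(1)])
  have mode: "?\<Phi> n \<in> ?V" if "n \<in> ?M" for n
    using that assms by (intro mode_in_ker_L) auto
  have sub: "subspace ?V" by (rule subspace_ker_L[OF assms(2)])
  show fin: "finite ?M" by (rule finite_M_set[OF assms(1)])
  show "basis_family ?\<Phi> ?M ?V"
  proof (rule basis_family_finiteI[OF fin _ sub mode])
    fix c assume "(\<Sum>n\<in>?M. c n *\<^sub>R ?\<Phi> n) = 0"
    then have "(\<Sum>n\<in>?M. c n *\<^sub>R ?\<Phi> n) (x, 1) = 0" for x by simp
    then have "(\<Sum>n\<in>?M. c n * ?\<Phi> n (x, 1)) = 0" for x by (simp add: sum_fun_apply)
    then have "c m * u ((real m * \<kappa>)\<^sup>2) 1 * N m = 0" if "m \<in> ?M" for m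
      using cos_coefficient_mode_sum[OF assms(1) fin, of c 1 m] that by (simp add: N_def)
    moreover have "u ((real m * \<kappa>)\<^sup>2) 1 \<noteq> 0" if "m \<in> ?M" for m
      using that by (simp add: M_set_def kernel_equation_def u_def power_mult_distrib)
    ultimately show "\<forall>n\<in>?M. c n = 0" using N by (metis mult_eq_0_iff)
  next
    fix \<Phi> assume \<Phi>: "\<Phi> \<in> ?V"
    have "\<forall>n. \<exists>c. (\<forall>s\<in>{0..1}. integral {0..pi / \<kappa>} (\<lambda>x. \<Phi> (x, s) * cos (real n * \<kappa> * x))
        = c * u ((real n * \<kappa>)\<^sup>2) s) \<and> (n \<notin> ?M \<longrightarrow> c = 0)"
    proof
      fix n
      show "\<exists>c. (\<forall>s\<in>{0..1}. integral {0..pi / \<kappa>} (\<lambda>x. \<Phi> (x, s) * cos (real n * \<kappa> * x))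
        = c * u ((real n * \<kappa>)\<^sup>2) s) \<and> (n \<notin> ?M \<longrightarrow> c = 0)"
        by (rule cos_coefficient_of_kernel_element[OF assms(1,2) \<Phi>, of n]) blast
    qed
    then obtain c where
      c: "\<And>n s. s \<in> {0..1} \<Longrightarrow> integral {0..pi / \<kappa>} (\<lambda>x. \<Phi> (x, s) * cos (real n * \<kappa> * x))
        = c n * u ((real n * \<kappa>)\<^sup>2) s" and c_0: "\<And>n. n \<notin> ?M \<Longrightarrow> c n = 0"
      by metis
    \<comment> \<open>The finite cosine expansion of \<open>\<Phi>\<close>; the division by \<open>N n\<close> normalises the cosines.\<close>
    define \<Psi> where "\<Psi> = (\<Sum>n\<in>?M. (c n / N n) *\<^sub>R ?\<Phi> n)"
    have \<Psi>: "\<Psi> \<in> ?V" unfolding \<Psi>_def by (intro subspace_sum sub subspace_scale mode)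
    have cont: "continuous_on {0..pi / \<kappa>} (\<lambda>x. \<Theta> (x, s))" if "\<Theta> \<in> ?V" "s \<in> {0..1}" for \<Theta> s
      using that continuous_on_X2_horizontal[of \<Theta> \<kappa> \<beta> s, OF _ assms(2)] by (simp add: ker_L_def)
    have "\<Phi> - \<Psi> = 0"
    proof (rule kernel_element_zero[OF assms(1,2)])
      show "\<Phi> - \<Psi> \<in> ?V" by (rule subspace_diff[OF sub \<Phi> \<Psi>])
      fix m and s :: real assume s: "s \<in> {0..1}"
      have "integral {0..pi / \<kappa>} (\<lambda>x. \<Psi> (x, s) * cos (real m * \<kappa> * x)) = c m * u ((real m * \<kappa>)\<^sup>2) s"
        using cos_coefficient_mode_sum[OF assms(1) fin, of "\<lambda>n. c n / N n" s m] N[of m] c_0[of m]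
        by (simp add: \<Psi>_def sum_fun_apply flip: N_def)
      moreover have "integral {0..pi / \<kappa>} (\<lambda>x. \<Phi> (x, s) * cos (real m * \<kappa> * x) - \<Psi> (x, s) * cos (real m * \<kappa> * x))
        = integral {0..pi / \<kappa>} (\<lambda>x. \<Phi> (x, s) * cos (real m * \<kappa> * x))
          - integral {0..pi / \<kappa>} (\<lambda>x. \<Psi> (x, s) * cos (real m * \<kappa> * x))"
        by (intro Henstock_Kurzweil_Integration.integral_diff integrable_continuous_real continuous_intros
            cont \<Phi> \<Psi> s)
      ultimately show "integral {0..pi / \<kappa>} (\<lambda>x. (\<Phi> - \<Psi>) (x, s) * cos (real m * \<kappa> * x)) = 0"
        using c[OF s] by (simp add: fun_diff_def left_diff_distrib)
    qed
    then show "\<exists>c. \<Phi> = (\<Sum>n\<in>?M. c n *\<^sub>R ?\<Phi> n)"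
      unfolding \<Psi>_def by (intro exI[of _ "\<lambda>n. c n / N n"]) simp
  qed
qed

end
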